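(* Every graph $G$ has a $\left(\leq 45\left(1+\frac{75}{9}\right)^{2|E(G)|-1}\right)$-subdivision $S$ with $\phi(S)\le 8$.
   Context: An anagram is a word of the form $WP$ where $W$ is a non-empty word and $P$ is a permutation of $W$. A vertex colouring of a graph is anagram-free if the sequence of colours along every path of the graph is not an anagram. $\phi(G)$ is the minimum number of colours in an anagram-free colouring of $G$. A subdivision of $G$ is obtained by replacing each edge $uv$ by a path with endpoints $u,v$; internal vertices are division vertices. A $(\le k)$-subdivision is a subdivision in which every edge receives at most $k$ division vertices. *)

theory Defs
  imports
    "HOL-Library.Multiset"
    "Graph_Theory.Pair_Digraph"
    "Graph_Theory.Vertex_Walk"
begin

text \<open>
  Finite simple graphs are values satisfying \<^const>\<open>pair_graph\<close>, that is, finite, symmetric and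
  loop-free: an undirected edge is represented by its two arcs.
\<close>

definition uedges :: "'a pair_pre_digraph \<Rightarrow> 'a set set" where
  "uedges G = {{u, v} | u v. (u, v) \<in> parcs G}"

definition anagram :: "'c list \<Rightarrow> bool" where
  "anagram xs \<longleftrightarrow> (\<exists>W P. xs = W @ P \<and> W \<noteq> [] \<and> mset P = mset W)"

definition anagram_free_colouring :: "'a pair_pre_digraph \<Rightarrow> ('a \<Rightarrow> 'c) \<Rightarrow> bool" where
  "anagram_free_colouring G c \<longleftrightarrow> (\<forall>p. vpath p (with_proj G) \<longrightarrow> \<not> anagram (map c p))"

definition phi :: "'a pair_pre_digraph \<Rightarrow> nat" where
  "phi G = (LEAST k. \<exists>c :: 'a \<Rightarrow> nat. c ` pverts G \<subseteq> {..<k} \<and> anagram_free_colouring G c)"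

text \<open>
  The minimum is over a nonempty set, and so is attained, for every finite graph.
\<close>

lemma phi_le_iff:
  fixes G :: "'a pair_pre_digraph"
  assumes "pair_graph G"
  shows "phi G \<le> k \<longleftrightarrow>
    (\<exists>c :: 'a \<Rightarrow> nat. c ` pverts G \<subseteq> {..<k} \<and> anagram_free_colouring G c)"
proof -
  let ?P = "\<lambda>k. \<exists>c :: 'a \<Rightarrow> nat. c ` pverts G \<subseteq> {..<k} \<and> anagram_free_colouring G c"
  interpret pair_graph G by fact
  obtain c :: "'a \<Rightarrow> nat" and n where c: "c ` pverts G = {i. i < n}" "inj_on c (pverts G)"
    using finite_imp_inj_to_nat_seg[OF pair_finite_verts] by blast
  have "\<not> anagram (map c p)" if "vpath p (with_proj G)" for p
  proof
    assume "anagram (map c p)"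
    then obtain W P where *: "map c p = W @ P" "W \<noteq> []" "mset P = mset W"
      by (auto simp: anagram_def)
    have "distinct (map c p)"
      using that c(2) by (auto simp: vpath_def vwalk_def distinct_map intro: inj_on_subset)
    then have "set W \<inter> set P = {}" using *(1) by simp
    moreover have "set P = set W" using *(3) by (rule mset_eq_setD)
    ultimately show False using *(2) by simp
  qed
  with c(1) have "?P n" by (auto simp: anagram_free_colouring_def)
  then have "?P (phi G)" unfolding phi_def by (rule LeastI)
  moreover have "?P k'" if "?P k" "k \<le> k'" for k k'
    using that by (meson lessThan_subset_iff order_trans)
  moreover have "phi G \<le> k" if "?P k"
    unfolding phi_def using that by (rule Least_le)
  ultimately show ?thesis by blast
qed

text \<open>
  In the following definition, \<open>h\<close> embeds the vertices of \<open>G\<close> into \<open>S\<close>, and \<open>D (u, v)\<close> lists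
  the division vertices of the edge \<open>uv\<close> in the order in which they are met from \<open>u\<close> to \<open>v\<close>.
  The two orientations of an edge therefore determine the same path of \<open>S\<close>, traversed in
  opposite directions.
\<close>

definition subdivides ::
  "'a pair_pre_digraph \<Rightarrow> 'b pair_pre_digraph \<Rightarrow> ('a \<Rightarrow> 'b) \<Rightarrow> ('a \<times> 'a \<Rightarrow> 'b list) \<Rightarrow> bool" where
  "subdivides G S h D \<longleftrightarrow>
     pair_graph S \<and>
     inj_on h (pverts G) \<and>
     (\<forall>(u, v) \<in> parcs G.
        D (v, u) = rev (D (u, v)) \<and> distinct (D (u, v)) \<and>
        set (D (u, v)) \<inter> h ` pverts G = {}) \<and>
     (\<forall>(u, v) \<in> parcs G. \<forall>(x, y) \<in> parcs G.
        {u, v} \<noteq> {x, y} \<longrightarrow> set (D (u, v)) \<inter> set (D (x, y)) = {}) \<and>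
     pverts S = h ` pverts G \<union> (\<Union>e \<in> parcs G. set (D e)) \<and>
     parcs S = (\<Union>(u, v) \<in> parcs G. set (vwalk_arcs (h u # D (u, v) @ [h v])))"

definition le_subdivision :: "real \<Rightarrow> 'a pair_pre_digraph \<Rightarrow> 'b pair_pre_digraph \<Rightarrow> bool" where
  "le_subdivision k G S \<longleftrightarrow>
     (\<exists>h D. subdivides G S h D \<and> (\<forall>e \<in> parcs G. real (length (D e)) \<le> k))"

end

(*
The first ingredient is an infinite word over five letters without anagrams: the fixed point of a
16-uniform morphism that commutes with the cyclic shift of the letters. Give the letter a the
weight 42^a modulo 181; then every image of a letter has weight 0. An anagram at positions
n1 < n2 < n3 makes the prefix weights at these positions an arithmetic progression modulo 181, and
they only depend on the letters around the positions within one image. A finite check shows that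
such a progression already holds for the letter counts themselves, and dividing the morphism out
gives an anagram at smaller positions.

All edges carry prefixes of this word, but the occurrences of one letter are replaced by four types,
arranged along every edge in stretches of the types 0, 1, 2, 3, 2, 1, 0, so that 4 + 4 colours are
used. The original vertices get type 3. Paths inside an edge are fine because of the word. For a
path W P through an original vertex, only three vertices matter: the first and the last of W and
the last of P. A stretch that contains none of them lies entirely in W, in P, or off the path. The
lengths of the stretches of one type are multiples of distinct powers of two, so if W and P contain
the type equally often and it is missed by the three vertices, no stretch of this type meets the
path. If type 3 is missed, the path would have to contain two original vertices but no stretch of
type 3, which is impossible; if it is hit, the path contains stretches of the types 0, 1 and 2, one
of which is missed by the other two vertices.
*)

theory Submission
  imports Defs "HOL-Library.Infinite_Set" "HOL-Library.Nat_Bijection"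
begin

section \<open>An anagram-free word over five letters\<close>

text \<open>
  The morphism maps a letter \<open>x\<close> to the sums \<open>(x + s) mod 5\<close> for \<open>s\<close> in this list, which was found by
  computer search.
\<close>

definition block :: "nat list" where
  "block = [0, 3, 1, 4, 3, 1, 2, 3, 4, 3, 2, 3, 0, 3, 4, 0]"

fun word :: "nat \<Rightarrow> nat" where
  "word n = (if n = 0 then 0 else (word (n div 16) + block ! (n mod 16)) mod 5)"

declare word.simps [simp del]

definition block_count :: "nat \<Rightarrow> nat \<Rightarrow> nat \<Rightarrow> int" where
  "block_count a t x = int (count_list (map (\<lambda>s. (x + s) mod 5) (take t block)) a)"

text \<open>
  Positions are rounded to a multiple of 16: a position in the last five places of a block is
  described by the part of the block that follows it, counted negatively. Without this shift the
  positions 1, 0 and 15 would form a progression modulo 16 for any block that begins and ends with the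
  same letter.
\<close>

definition offset :: "nat \<Rightarrow> nat \<Rightarrow> nat \<Rightarrow> int" where
  "offset t x a = block_count a t x - (if t < 11 then 0 else block_count a 16 x)"

text \<open>The coefficients are the powers of 42 modulo 181. Since 42 has order 5 there, a cyclic
  shift of the letters multiplies the weight by 42, so all five images of letters have weight 0 as
  soon as one has.\<close>

definition weight :: "(nat \<Rightarrow> int) \<Rightarrow> int" where
  "weight c = c 0 + 42 * c 1 + 135 * c 2 + 59 * c 3 + 125 * c 4"

definition offsets :: "(int \<times> int list) list list" where
  "offsets = map (\<lambda>t. map (\<lambda>x. (weight (offset t x) mod 181, map (offset t x) [0..<5])) [0..<5]) [0..<16]"

text \<open>The table is spelled out as a code equation so that the checks below read off numbers
  instead of recounting letters. Row \<open>t\<close>, column \<open>x\<close> holds the residue of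
  the weight and the counts of the five letters.\<close>

lemma offsets_code [code]: "offsets =
    [[(0, [0, 0, 0, 0, 0]), (0, [0, 0, 0, 0, 0]), (0, [0, 0, 0, 0, 0]), (0, [0, 0, 0, 0, 0]), (0, [0, 0, 0, 0, 0])],
     [(1, [1, 0, 0, 0, 0]), (42, [0, 1, 0, 0, 0]), (135, [0, 0, 1, 0, 0]), (59, [0, 0, 0, 1, 0]), (125, [0, 0, 0, 0, 1])],
     [(60, [1, 0, 0, 1, 0]), (167, [0, 1, 0, 0, 1]), (136, [1, 0, 1, 0, 0]), (101, [0, 1, 0, 1, 0]), (79, [0, 0, 1, 0, 1])],
     [(102, [1, 1, 0, 1, 0]), (121, [0, 1, 1, 0, 1]), (14, [1, 0, 1, 1, 0]), (45, [0, 1, 0, 1, 1]), (80, [1, 0, 1, 0, 1])],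
     [(46, [1, 1, 0, 1, 1]), (122, [1, 1, 1, 0, 1]), (56, [1, 1, 1, 1, 0]), (180, [0, 1, 1, 1, 1]), (139, [1, 0, 1, 1, 1])],
     [(105, [1, 1, 0, 2, 1]), (66, [1, 1, 1, 0, 2]), (57, [2, 1, 1, 1, 0]), (41, [0, 2, 1, 1, 1]), (93, [1, 0, 2, 1, 1])],
     [(147, [1, 2, 0, 2, 1]), (20, [1, 1, 2, 0, 2]), (116, [2, 1, 1, 2, 0]), (166, [0, 2, 1, 1, 2]), (94, [2, 0, 2, 1, 1])],
     [(101, [1, 2, 1, 2, 1]), (79, [1, 1, 2, 1, 2]), (60, [2, 1, 1, 2, 1]), (167, [1, 2, 1, 1, 2]), (136, [2, 1, 2, 1, 1])],
     [(160, [1, 2, 1, 3, 1]), (23, [1, 1, 2, 1, 3]), (61, [3, 1, 1, 2, 1]), (28, [1, 3, 1, 1, 2]), (90, [2, 1, 3, 1, 1])],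
     [(104, [1, 2, 1, 3, 2]), (24, [2, 1, 2, 1, 3]), (103, [3, 2, 1, 2, 1]), (163, [1, 3, 2, 1, 2]), (149, [2, 1, 3, 2, 1])],
     [(163, [1, 2, 1, 4, 2]), (149, [2, 1, 2, 1, 4]), (104, [4, 2, 1, 2, 1]), (24, [1, 4, 2, 1, 2]), (103, [2, 1, 4, 2, 1])],
     [(117, [-2, 0, 0, -2, -1]), (27, [-1, -2, 0, 0, -2]), (48, [-2, -1, -2, 0, 0]), (25, [0, -2, -1, -2, 0]), (145, [0, 0, -2, -1, -2])],
     [(176, [-2, 0, 0, -1, -1]), (152, [-1, -2, 0, 0, -1]), (49, [-1, -1, -2, 0, 0]), (67, [0, -1, -1, -2, 0]), (99, [0, 0, -1, -1, -2])],
     [(177, [-1, 0, 0, -1, -1]), (13, [-1, -1, 0, 0, -1]), (3, [-1, -1, -1, 0, 0]), (126, [0, -1, -1, -1, 0]), (43, [0, 0, -1, -1, -1])],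
     [(55, [-1, 0, 0, 0, -1]), (138, [-1, -1, 0, 0, 0]), (4, [0, -1, -1, 0, 0]), (168, [0, 0, -1, -1, 0]), (178, [0, 0, 0, -1, -1])],
     [(180, [-1, 0, 0, 0, 0]), (139, [0, -1, 0, 0, 0]), (46, [0, 0, -1, 0, 0]), (122, [0, 0, 0, -1, 0]), (56, [0, 0, 0, 0, -1])]]"
  by code_simp

lemma weight_block_count: "x < 5 \<Longrightarrow> weight (\<lambda>a. block_count a 16 x) mod 181 = 0"
proof -
  have "list_all (\<lambda>x. weight (\<lambda>a. block_count a 16 x) mod 181 = 0) [0..<5]"
    by code_simp
  then show "x < 5 \<Longrightarrow> weight (\<lambda>a. block_count a 16 x) mod 181 = 0"
    by (auto simp: list_all_iff)
qed

lemma nth_offsets: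
  "t < 16 \<Longrightarrow> x < 5 \<Longrightarrow>
    offsets ! t ! x = (weight (offset t x) mod 181, map (offset t x) [0..<5])"
  by (simp add: offsets_def del: upt_Suc)

text \<open>Three residues between 0 and 180 put \<open>s - w\<close> strictly between -362 and 362,
  where only three multiples of 181 lie. The checks can therefore recognise progressions modulo 181
  by comparisons alone.\<close>

lemma progression_iff:
  fixes v1 v2 v3 :: int
  defines "s \<equiv> v1 mod 181 + v3 mod 181" and "w \<equiv> 2 * (v2 mod 181)"
  shows "s = w \<or> s = w + 181 \<or> s = w - 181 \<longleftrightarrow> (v1 + v3 - 2 * v2) mod 181 = 0"
proof -
  have bounds: "- 362 < s - w" "s - w < 362"
    using pos_mod_sign[of 181 v1] pos_mod_sign[of 181 v2] pos_mod_sign[of 181 v3]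
      pos_mod_bound[of 181 v1] pos_mod_bound[of 181 v2] pos_mod_bound[of 181 v3]
    unfolding s_def w_def by linarith+
  have "(v1 + v3 - 2 * v2) mod 181 = (s - w) mod 181"
    unfolding s_def w_def by (intro mod_diff_cong mod_add_cong mod_mult_cong) simp_all
  moreover have "(s - w) mod 181 = 0 \<longleftrightarrow> s - w \<in> {0, 181, - 181}"
  proof
    assume "(s - w) mod 181 = 0"
    then obtain k where "s - w = 181 * k" by auto
    with bounds have "k = 0 \<or> k = 1 \<or> k = - 1" by linarith
    with \<open>s - w = 181 * k\<close> show "s - w \<in> {0, 181, - 181}" by auto
  qed auto
  ultimately show ?thesis by auto
qed

text \<open>The third place of a progression is determined modulo 16 by the other two; adding 16
  before subtracting \<open>t1\<close> avoids truncation. All triples of letters are tried, whether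
  or not they occur together in the word.\<close>

lemma exact_check:
  "list_all (\<lambda>t1. list_all (\<lambda>t2.
     list_all (\<lambda>(v2, p2). let w = 2 * v2; w' = w + 181; w'' = w - 181 in
       list_all (\<lambda>(v1, p1). list_all (\<lambda>(v3, p3). let s = v1 + v3 in
         if s = w \<or> s = w' \<or> s = w'' then map2 (+) p1 p3 = map2 (+) p2 p2 else True)
     (offsets ! ((2 * t2 + 16 - t1) mod 16))) (offsets ! t1)) (offsets ! t2)) [0..<16]) [0..<16]"
  by code_simp

text \<open>
  This check concerns three positions that round to the same multiple of 16, at the boundary of the
  blocks of two different letters.
\<close>

definition window :: "nat \<Rightarrow> nat \<Rightarrow> int list" where
  "window x y = map (\<lambda>s. fst (offsets ! ((s + 11) mod 16) ! (if s < 5 then x else y))) [0..<16]"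

text \<open>The lower bound for \<open>s1\<close> keeps \<open>2 * s2 - s1\<close> below 16; for
  small \<open>s2\<close> truncated subtraction turns this bound into 0.\<close>

definition progression_free :: "int list \<Rightarrow> bool" where
  "progression_free vs = list_all (\<lambda>(s1, s2, s3).
     let s = vs ! s1 + vs ! s3; w = 2 * vs ! s2 in \<not> (s = w \<or> s = w + 181 \<or> s = w - 181))
     [(s1, s2, 2 * s2 - s1). s2 \<leftarrow> [0..<16], s1 \<leftarrow> [2 * s2 - 15..<s2]]"

lemma window_check:
  "list_all (\<lambda>x. list_all (\<lambda>y. if x = y then True else progression_free (window x y)) [0..<5]) [0..<5]"
  by code_simp

section \<open>Block structure of the word\<close>

lemma word_lt_5: "word n < 5"
  by (subst word.simps) simp

lemma word_block:
  assumes "t < 16"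
  shows "word (16 * q + t) = (word q + block ! t) mod 5"
proof (cases "16 * q + t = 0")
  case True
  then show ?thesis by (simp add: word.simps block_def)
next
  case False
  then show ?thesis using assms by (subst word.simps) auto
qed

lemma length_block [simp]: "length block = 16"
  by (simp add: block_def)

lemma block_lt_5: "t < 16 \<Longrightarrow> block ! t < 5"
proof -
  have "list_all (\<lambda>x. x < 5) block" by (simp add: block_def)
  then show "t < 16 \<Longrightarrow> block ! t < 5" by (simp add: list_all_length)
qed

lemma block_step: "t < 15 \<Longrightarrow> block ! Suc t \<noteq> block ! t"
proof -
  have "list_all (\<lambda>t. block ! Suc t \<noteq> block ! t) [0..<15]" by code_simp
  then show "t < 15 \<Longrightarrow> block ! Suc t \<noteq> block ! t" by (simp add: list_all_iff)
qed

text \<open>Inside a block this is a property of \<open>block\<close>. At a block boundary both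
  shifts are 0, as \<open>block\<close> starts and ends with 0, and the two letters are those of
  consecutive positions one level down. It justifies restricting the window check to different
  letters.\<close>

lemma word_Suc_neq: "word (Suc n) \<noteq> word n"
proof (induction n rule: less_induct)
  case (less n)
  define q t where "q = n div 16" and "t = n mod 16"
  have n: "n = 16 * q + t" "t < 16" by (auto simp: q_def t_def)
  show ?case
  proof (cases "t = 15")
    case True
    have "word (Suc q) \<noteq> word q" using less.IH[of q] n True by simp
    moreover have "word (Suc n) = word (Suc q)"
      using word_block[of 0 "Suc q"] n True word_lt_5[of "Suc q"] by (simp add: block_def)
    moreover have "word n = word q"
      using word_block[of 15 q] n True word_lt_5[of q] by (simp add: block_def)
    ultimately show ?thesis by simp
  next
    case False
    then have t: "t < 15" using n(2) by simp
    have "(word q + block ! Suc t) mod 5 \<noteq> (word q + block ! t) mod 5"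
      using block_step[OF t] block_lt_5[of t] block_lt_5[of "Suc t"] word_lt_5[of q] t
      by (cases "word q + block ! Suc t < 5"; cases "word q + block ! t < 5")
        (auto simp: le_mod_geq not_less)
    then show ?thesis
      using word_block[of t q] word_block[of "Suc t" q] n t by simp
  qed
qed

section \<open>Letter counts of prefixes and the incidence matrix of the morphism\<close>

definition letter_count :: "nat \<Rightarrow> nat \<Rightarrow> int" where
  "letter_count a n = (\<Sum>s<n. of_bool (word s = a))"

text \<open>This is the incidence matrix of the morphism applied to a vector of letter
  counts.\<close>

definition substituted :: "(nat \<Rightarrow> int) \<Rightarrow> nat \<Rightarrow> int" where
  "substituted c a = (\<Sum>b<5. c b * block_count a 16 b)"

lemma block_count_0 [simp]: "block_count a 0 x = 0"
  by (simp add: block_count_def)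

lemma block_count_Suc:
  "t < 16 \<Longrightarrow> block_count a (Suc t) x = block_count a t x + of_bool ((x + block ! t) mod 5 = a)"
  by (simp add: block_count_def take_Suc_conv_app_nth)

lemma letter_count_add_block:
  "t \<le> 16 \<Longrightarrow> letter_count a (16 * q + t) = letter_count a (16 * q) + block_count a t (word q)"
proof (induction t)
  case (Suc t)
  then show ?case by (simp add: letter_count_def block_count_Suc word_block)
qed simp

lemma letter_count_Suc: "letter_count a (Suc n) = letter_count a n + of_bool (word n = a)"
  by (simp add: letter_count_def)

lemma letter_count_blocks: "letter_count a (16 * q) = substituted (\<lambda>b. letter_count b q) a"
proof (induction q)
  case 0
  then show ?case by (simp add: letter_count_def substituted_def)
next
  case (Suc q)
  have "letter_count a (16 * Suc q) = letter_count a (16 * q) + block_count a 16 (word q)"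
    using letter_count_add_block[of 16 a q] by (simp add: algebra_simps)
  also have "\<dots> = substituted (\<lambda>b. letter_count b q) a + (\<Sum>b<5. of_bool (word q = b) * block_count a 16 b)"
  proof -
    have "(\<Sum>b<5. of_bool (word q = b) * block_count a 16 b) =
        (\<Sum>b<5. if word q = b then block_count a 16 b else 0)"
      by (intro sum.cong) auto
    then show ?thesis using word_lt_5[of q] Suc by simp
  qed
  also have "\<dots> = substituted (\<lambda>b. letter_count b (Suc q)) a"
    by (simp add: substituted_def letter_count_Suc algebra_simps sum.distrib)
  finally show ?case .
qed

text \<open>The places 11 to 15 of a block are rounded up and all others down, which is what adding
  5 before the division does. The prefix up to the rounded position consists of whole images of
  letters.\<close>

lemma letter_count_eq:
  "letter_count a n = substituted (\<lambda>b. letter_count b ((n + 5) div 16)) a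
     + offset (n mod 16) (word (n div 16)) a"
proof -
  define q t where "q = n div 16" and "t = n mod 16"
  have n: "n = 16 * q + t" "t < 16" by (auto simp: q_def t_def)
  have *: "letter_count a n = letter_count a (16 * q) + block_count a t (word q)"
    using letter_count_add_block[of t a q] n by simp
  show ?thesis
  proof (cases "t < 11")
    case True
    then have "(n + 5) div 16 = q" using n by simp
    with * True show ?thesis by (simp add: offset_def letter_count_blocks q_def t_def)
  next
    case False
    then have "(n + 5) div 16 = Suc q" using n by simp
    moreover have "letter_count a (16 * Suc q) = letter_count a (16 * q) + block_count a 16 (word q)"
      using letter_count_add_block[of 16 a q] by (simp add: algebra_simps)
    ultimately show ?thesis using * False letter_count_blocks[of a "Suc q"]
      by (simp add: offset_def q_def t_def)
  qed
qed

lemma lessThan_5: "{..<5::nat} = {0, 1, 2, 3, 4}"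
  by auto

lemma sum_letter_count: "(\<Sum>a<5. letter_count a n) = int n"
  by (induction n) (use word_lt_5 in \<open>simp_all add: letter_count_Suc sum.distrib letter_count_def\<close>)

lemma block_count_table:
  "map (\<lambda>a. map (block_count a 16) [0..<5]) [0..<5] =
    [[3, 3, 6, 2, 2], [2, 3, 3, 6, 2], [2, 2, 3, 3, 6], [6, 2, 2, 3, 3], [3, 6, 2, 2, 3]]"
  by code_simp

text \<open>The incidence matrix, a circulant since the morphism commutes with the cyclic shift, is
  nonsingular. This is what allows the morphism to be divided out.\<close>

lemma substituted_eq_0D:
  assumes "\<And>a. a < 5 \<Longrightarrow> substituted c a = 0" and "b < 5"
  shows "c b = 0"
proof -
  have "substituted c 0 = 3 * c 0 + 3 * c 1 + 6 * c 2 + 2 * c 3 + 2 * c 4"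
    "substituted c 1 = 2 * c 0 + 3 * c 1 + 3 * c 2 + 6 * c 3 + 2 * c 4"
    "substituted c 2 = 2 * c 0 + 2 * c 1 + 3 * c 2 + 3 * c 3 + 6 * c 4"
    "substituted c 3 = 6 * c 0 + 2 * c 1 + 2 * c 2 + 3 * c 3 + 3 * c 4"
    "substituted c 4 = 3 * c 0 + 6 * c 1 + 2 * c 2 + 2 * c 3 + 3 * c 4"
    using block_count_table by (simp_all add: substituted_def lessThan_5 upt_rec numeral_2_eq_2[symmetric])
  then have "c 0 = 0 \<and> c 1 = 0 \<and> c 2 = 0 \<and> c 3 = 0 \<and> c 4 = 0"
    using assms(1)[of 0] assms(1)[of 1] assms(1)[of 2] assms(1)[of 3] assms(1)[of 4] by simp
  moreover have "b \<in> {0, 1, 2, 3, 4}" using assms(2) by auto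
  ultimately show ?thesis by auto
qed

lemma weight_substituted: "weight (substituted c) mod 181 = 0"
proof -
  have "weight (substituted c) = (\<Sum>b<5. c b * weight (\<lambda>a. block_count a 16 b))"
    by (simp add: weight_def substituted_def sum_distrib_left sum.distrib algebra_simps)
  also have "\<dots> mod 181 = (\<Sum>b<5. c b * weight (\<lambda>a. block_count a 16 b) mod 181) mod 181"
    by (rule mod_sum_eq[symmetric])
  also have "(\<Sum>b<5. c b * weight (\<lambda>a. block_count a 16 b) mod 181) = 0"
    using weight_block_count by (intro sum.neutral) (metis dvd_eq_mod_eq_0 dvd_mult lessThan_iff)
  finally show ?thesis by simp
qed

section \<open>Descent for progressions of letter counts\<close>

lemma exactD:
  assumes t: "t1 < 16" "t2 < 16" "t3 < 16" "(t1 + t3) mod 16 = (2 * t2) mod 16"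
    and x: "x1 < 5" "x2 < 5" "x3 < 5"
    and dvd: "(weight (offset t1 x1) + weight (offset t3 x3) - 2 * weight (offset t2 x2)) mod 181 = 0"
    and "a < 5"
  shows "offset t1 x1 a + offset t3 x3 a = 2 * offset t2 x2 a"
proof -
  let ?p = "\<lambda>t x. (weight (offset t x) mod 181, map (offset t x) [0..<5])"
  have in_set: "?p t x \<in> set (offsets ! t)" if "t < 16" "x < 5" for t x
  proof -
    have "x < length (offsets ! t)"
      using that by (simp add: offsets_def del: upt_Suc)
    then show ?thesis
      using nth_offsets[OF that] by (metis nth_mem)
  qed
  \<comment> \<open>Before reduction the place computed in the check is \<open>t3\<close>,
    \<open>t3 + 16\<close> or \<open>t3 + 32\<close>, depending on how the congruence modulo 16 is
    met.\<close>
  have t3: "(2 * t2 + 16 - t1) mod 16 = t3"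
  proof -
    have "t1 + t3 = 2 * t2 \<or> t1 + t3 = 2 * t2 + 16 \<or> t1 + t3 + 16 = 2 * t2"
      using t by (cases "t1 + t3 < 16"; cases "2 * t2 < 16") (auto simp: le_mod_geq not_less)
    then have "2 * t2 + 16 - t1 = t3 + 16 * 0 \<or> 2 * t2 + 16 - t1 = t3 + 16 * 1 \<or>
        2 * t2 + 16 - t1 = t3 + 16 * 2"
      by auto
    then show ?thesis
      using t(3) by (elim disjE) (simp_all only: mod_mult_self2 mod_less)
  qed
  have ts: "t1 \<in> set [0..<16]" "t2 \<in> set [0..<16]"
    using t(1,2) by auto
  have "map2 (+) (map (offset t1 x1) [0..<5]) (map (offset t3 x3) [0..<5]) =
      map2 (+) (map (offset t2 x2) [0..<5]) (map (offset t2 x2) [0..<5])"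
    using exact_check[unfolded list_all_iff Let_def, rule_format, OF ts in_set[OF t(2) x(2)],
        unfolded split, rule_format, OF in_set[OF t(1) x(1)], unfolded split t3, rule_format,
        OF in_set[OF t(3) x(3)], unfolded split progression_iff] dvd
    by (simp del: upt_Suc)
  from arg_cong[OF this, of "\<lambda>l. l ! a"] show ?thesis
    using \<open>a < 5\<close> by (simp del: upt_Suc)
qed

lemma nth_window:
  "s < 16 \<Longrightarrow> window x y ! s = fst (offsets ! ((s + 11) mod 16) ! (if s < 5 then x else y))"
  unfolding window_def by (subst nth_map_upt) auto

lemma windowD:
  assumes xy: "x < 5" "y < 5" "x \<noteq> y" and s: "s1 < s2" "s1 + s3 = 2 * s2" "s3 < 16"
  defines "v \<equiv> \<lambda>s. weight (offset ((s + 11) mod 16) (if s < 5 then x else y))"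
  shows "(v s1 + v s3 - 2 * v s2) mod 181 \<noteq> 0"
proof -
  have v: "window x y ! s = v s mod 181" if "s < 16" for s
    using that xy by (simp add: nth_window nth_offsets v_def)
  have mem: "(s1, s2, s3) \<in> set [(s1, s2, 2 * s2 - s1). s2 \<leftarrow> [0..<16], s1 \<leftarrow> [2 * s2 - 15..<s2]]"
    using s by (auto simp del: upt_Suc upt_rec_numeral simp: image_iff intro!: bexI[of _ s2] bexI[of _ s1])
  have free: "progression_free (window x y)"
    using window_check xy unfolding list_all_iff by (metis atLeastLessThan_iff atLeastLessThan_upt le0)
  have "s1 < 16" "s2 < 16" using s by auto
  then show ?thesis
    using bspec[OF free[unfolded progression_free_def list_all_iff Let_def] mem, unfolded split]
    unfolding v[OF \<open>s1 < 16\<close>] v[OF \<open>s2 < 16\<close>] v[OF s(3)] progression_iff by blast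
qed

text \<open>Descent on \<open>n3\<close>: by the weights and the exact check, the counts at the
  rounded positions form a progression as well. Either the rounded positions are strictly increasing
  and the induction hypothesis applies, or they coincide and the three positions share a window,
  which the second check excludes.\<close>

lemma word_no_progression:
  assumes "n1 < n2" "n2 < n3"
    and "\<And>a. a < 5 \<Longrightarrow> letter_count a n1 + letter_count a n3 = 2 * letter_count a n2"
  shows False
  using assms
proof (induction n3 arbitrary: n1 n2 rule: less_induct)
  case (less n3)
  note eq = less.prems(3)
  define t x q where "t = (\<lambda>n. n mod 16 :: nat)" and "x = (\<lambda>n. word (n div 16))"
    and "q = (\<lambda>n. (n + 5) div 16 :: nat)"
  have "(\<Sum>a<5. letter_count a n1 + letter_count a n3) = (\<Sum>a<5. 2 * letter_count a n2)"
    using eq by (intro sum.cong) auto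
  then have len: "n1 + n3 = 2 * n2"
    by (simp add: sum.distrib sum_letter_count flip: sum_distrib_left)
  define c where "c = (\<lambda>b. letter_count b (q n1) + letter_count b (q n3) - 2 * letter_count b (q n2))"
  have count: "letter_count a n = substituted (\<lambda>b. letter_count b (q n)) a + offset (t n) (x n) a" for a n
    unfolding q_def t_def x_def by (rule letter_count_eq)
  have sub: "substituted c a + (offset (t n1) (x n1) a + offset (t n3) (x n3) a - 2 * offset (t n2) (x n2) a) = 0"
    if "a < 5" for a
    using eq[OF that] unfolding count[of a n1] count[of a n2] count[of a n3] c_def
    by (simp add: substituted_def algebra_simps sum.distrib sum_subtractf flip: sum_distrib_left)
  \<comment> \<open>\<open>substituted c\<close> has weight 0 modulo 181, so taking weights leaves a
    relation between the offsets only.\<close>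
  have "weight (substituted c) + (weight (offset (t n1) (x n1)) + weight (offset (t n3) (x n3))
      - 2 * weight (offset (t n2) (x n2))) = 0"
    using sub[of 0] sub[of 1] sub[of 2] sub[of 3] sub[of 4] by (simp add: weight_def)
  then have dvd: "(weight (offset (t n1) (x n1)) + weight (offset (t n3) (x n3))
      - 2 * weight (offset (t n2) (x n2))) mod 181 = 0"
    using weight_substituted[of c] by (simp add: mod_eq_0_iff_dvd add_eq_0_iff)
  have "(t n1 + t n3) mod 16 = (2 * t n2) mod 16"
    using len unfolding t_def by (metis mod_add_eq mod_mult_right_eq)
  then have "offset (t n1) (x n1) a + offset (t n3) (x n3) a = 2 * offset (t n2) (x n2) a" if "a < 5" for a
    using exactD[OF _ _ _ _ _ _ _ dvd that] by (simp add: t_def x_def word_lt_5)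
  then have "c b = 0" if "b < 5" for b
    using sub substituted_eq_0D[of c b] that by force
  then have descent: "letter_count b (q n1) + letter_count b (q n3) = 2 * letter_count b (q n2)" if "b < 5" for b
    using that unfolding c_def by force
  have "(\<Sum>a<5. letter_count a (q n1) + letter_count a (q n3)) = (\<Sum>a<5. 2 * letter_count a (q n2))"
    using descent by (intro sum.cong) auto
  then have qlen: "q n1 + q n3 = 2 * q n2"
    by (simp add: sum.distrib sum_letter_count flip: sum_distrib_left)
  have "q n1 \<le> q n2" "q n2 \<le> q n3" "q n3 < n3"
    using less.prems(1,2) unfolding q_def by auto
  show False
  proof (cases "q n1 = q n2")
    case False
    then have "q n1 < q n2" "q n2 < q n3"
      using \<open>q n1 \<le> q n2\<close> \<open>q n2 \<le> q n3\<close> qlen by linarith+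
    then show False
      using less.IH[OF \<open>q n3 < n3\<close>] descent by blast
  next
    case True
    define r where "r = q n1"
    have r: "q n1 = r" "q n2 = r" "q n3 = r" using True qlen by (auto simp: r_def)
    \<comment> \<open>\<open>s\<close> is the place in the window: below 5 the position precedes
      \<open>16 * r\<close> and belongs to the previous block, from 5 on it belongs to block
      \<open>r\<close>.\<close>
    define s where "s = (\<lambda>n. n + 5 - 16 * r)"
    have s: "n + 5 = 16 * r + s n" "s n < 16" if "q n = r" for n
      using that unfolding q_def s_def by auto
    \<comment> \<open>\<open>z\<close> is the letter of the previous block. For \<open>r = 0\<close>
      there is none and no position has a place below 5; any letter other than \<open>word r\<close>
      will do.\<close>
    define z where "z = (if r = 0 then (word r + 1) mod 5 else word (r - 1))"
    have z: "z < 5" "z \<noteq> word r"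
      using word_lt_5[of r] word_lt_5[of "r - 1"] word_Suc_neq[of "r - 1"]
      by (auto simp: z_def mod_Suc)
    define y where "y = (\<lambda>s::nat. if s < 5 then z else word r)"
    have off: "offset (t n) (x n) = offset ((s n + 11) mod 16) (y (s n))" if "q n = r" for n
    proof (cases "s n < 5")
      case True
      then have "r \<noteq> 0" and n: "n = 16 * (r - 1) + (s n + 11)"
        using s[OF that] by (cases r; auto)+
      have "n div 16 = r - 1" "n mod 16 = s n + 11"
        using True by (subst n; simp)+
      then show ?thesis using True \<open>r \<noteq> 0\<close> by (simp add: t_def x_def y_def z_def)
    next
      case False
      then have n: "n = 16 * r + (s n - 5)" and "s n + 11 = 16 + (s n - 5)"
        using s(1)[OF that] by linarith+
      then have "(s n + 11) mod 16 = s n - 5"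
        using s(2)[OF that] by (metis mod_add_self1 mod_less less_imp_diff_less)
      moreover have "n div 16 = r" "n mod 16 = s n - 5"
        using s(2)[OF that] by (subst n; simp)+
      moreover note False
      ultimately show ?thesis by (simp add: t_def x_def y_def)
    qed
    have "s n1 < s n2" "s n1 + s n3 = 2 * s n2" "s n3 < 16"
      using s[OF r(1)] s[OF r(2)] s[OF r(3)] len less.prems(1) by linarith+
    then show False
      using windowD[OF z(1) word_lt_5 z(2), of "s n1" "s n2" "s n3"] dvd
      unfolding off[OF r(1)] off[OF r(2)] off[OF r(3)] y_def by simp
  qed
qed

section \<open>Positions of the letter 0\<close>

definition zeros :: "nat set" where
  "zeros = {n. word n = 0}"

definition zero_pos :: "nat \<Rightarrow> nat" where
  "zero_pos = enumerate zeros"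

text \<open>\<open>block\<close> contains every residue modulo 5, so every image contains the letter
  0. Both the infinitude of \<open>zeros\<close> and the linear bound on \<open>zero_pos\<close>
  rest on this.\<close>

lemma zero_in_block: "\<exists>n \<in> {16 * q..<16 * q + 16}. n \<in> zeros"
proof -
  have *: "list_all (\<lambda>x. list_ex (\<lambda>t. (x + block ! t) mod 5 = 0) [0..<16]) [0..<5]"
    by code_simp
  have "word q \<in> set [0..<5]" using word_lt_5 by simp
  from bspec[OF *[unfolded list_all_iff] this]
  obtain t where t: "t < 16" "(word q + block ! t) mod 5 = 0"
    by (auto simp: list_ex_iff simp del: upt_rec_numeral)
  then have "16 * q + t \<in> zeros"
    by (simp add: zeros_def word_block)
  with t(1) show ?thesis by (intro bexI[of _ "16 * q + t"]) auto
qed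

lemma infinite_zeros: "infinite zeros"
  unfolding infinite_nat_iff_unbounded_le
proof
  fix m
  obtain n where "n \<in> {16 * m..<16 * m + 16}" "n \<in> zeros"
    using zero_in_block[of m] by blast
  then show "\<exists>n\<ge>m. n \<in> zeros" by (intro exI[of _ n]) auto
qed

lemma zero_pos_less_iff [simp]: "zero_pos j < zero_pos k \<longleftrightarrow> j < k"
  unfolding zero_pos_def using infinite_zeros by (simp add: enumerate_mono_iff)

lemma zero_pos_le_iff [simp]: "zero_pos j \<le> zero_pos k \<longleftrightarrow> j \<le> k"
  by (metis linorder_not_le zero_pos_less_iff)

lemma word_zero_pos [simp]: "word (zero_pos k) = 0"
  using enumerate_in_set[OF infinite_zeros] by (auto simp: zero_pos_def zeros_def)

lemma zero_pos_surj: "word n = 0 \<Longrightarrow> \<exists>k. n = zero_pos k"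
  using enumerate_Ex[of zeros n] infinite_zeros by (auto simp: zero_pos_def zeros_def)

lemma le_zero_pos: "k \<le> zero_pos k"
  unfolding zero_pos_def by (rule le_enumerate[OF infinite_zeros])

lemma zero_pos_upper: "zero_pos k < 16 * k + 16"
proof (induction k)
  case 0
  have "word 0 = 0" by (simp add: word.simps)
  then obtain k where "0 = zero_pos k" using zero_pos_surj by blast
  then have "zero_pos 0 \<le> 0" by (metis le0 zero_pos_le_iff)
  then show ?case by simp
next
  case (Suc k)
  obtain n where n: "n \<in> {16 * Suc k..<16 * Suc k + 16}" "n \<in> zeros"
    using zero_in_block[of "Suc k"] by blast
  then obtain j where j: "n = zero_pos j"
    using zero_pos_surj by (auto simp: zeros_def)
  have "zero_pos k < n" using Suc n(1) by simp
  then have "Suc k \<le> j" unfolding j by simp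
  then have "zero_pos (Suc k) \<le> n" unfolding j by (simp only: zero_pos_le_iff)
  with n(1) show ?case by simp
qed

lemma zeros_between: "{t. zero_pos j \<le> t \<and> t < zero_pos k \<and> word t = 0} = zero_pos ` {j..<k}"
  by (force dest: zero_pos_surj)

lemma card_zeros_between: "card {t. zero_pos j \<le> t \<and> t < zero_pos k \<and> word t = 0} = k - j"
proof -
  have "inj zero_pos"
    by (rule injI) (metis linorder_neqE_nat less_irrefl zero_pos_less_iff)
  then show ?thesis
    unfolding zeros_between by (simp add: card_image inj_on_subset)
qed

lemma letter_count_diff:
  assumes "m \<le> n"
  shows "letter_count a n - letter_count a m = int (card {t \<in> {m..<n}. word t = a})"
proof -
  have "letter_count a n = letter_count a m + (\<Sum>s\<in>{m..<n}. of_bool (word s = a))"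
    unfolding letter_count_def lessThan_atLeast0
    by (rule sum.atLeastLessThan_concat[symmetric]) (use assms in auto)
  also have "(\<Sum>s\<in>{m..<n}. of_bool (word s = a)) = int (card {t \<in> {m..<n}. word t = a})"
    by (simp add: of_bool_def sum.If_cases Int_def)
  finally show ?thesis by simp
qed

text \<open>Equal counts in two adjacent factors mean that the prefix counts at their three
  boundaries are in progression.\<close>

lemma word_anagram_free:
  assumes "l < m" "m < n"
  shows "\<exists>a<5. card {t \<in> {l..<m}. word t = a} \<noteq> card {t \<in> {m..<n}. word t = a}"
proof (rule ccontr)
  assume "\<not> ?thesis"
  then have "letter_count a l + letter_count a n = 2 * letter_count a m" if "a < 5" for a
    using letter_count_diff[of l m a] letter_count_diff[of m n a] assms that by fastforce
  with assms show False by (rule word_no_progression)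
qed

section \<open>Paths and separating vertices\<close>

lemma walk_cut:
  assumes "successively R q" "\<And>x y. x \<in> set q \<inter> J \<Longrightarrow> y \<in> set q - J \<Longrightarrow> \<not> R x y \<and> \<not> R y x"
  shows "set q \<subseteq> J \<or> set q \<inter> J = {}"
  using assms
proof (induction q rule: induct_list012)
  case (3 x y zs)
  have "set (y # zs) \<subseteq> J \<or> set (y # zs) \<inter> J = {}"
    using 3(3,4) by (intro 3(2)) auto
  moreover have "x \<in> J \<longleftrightarrow> y \<in> J"
    using 3(3) 3(4)[of x y] 3(4)[of y x] by auto
  ultimately show ?case by auto
qed auto

text \<open>The path would have to enter and leave \<open>J\<close>. The vertex just before its
  first vertex in \<open>J\<close> and the one just after its last are different, but both would
  have to be \<open>c\<close>.\<close>

lemma path_cut_point: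
  assumes "distinct q" "successively R q" "set q \<inter> J \<noteq> {}" "hd q \<notin> J" "last q \<notin> J"
    and out: "\<And>x y. x \<in> set q \<inter> J \<Longrightarrow> y \<in> set q - J \<Longrightarrow> R x y \<or> R y x \<Longrightarrow> y = c"
  shows False
proof -
  from assms(3) have "\<exists>x \<in> set q. x \<in> J" by blast
  then obtain xs x ys where q: "q = xs @ x # ys" "x \<in> J" "\<forall>y \<in> set xs. y \<notin> J"
    using split_list_first_prop[of q "\<lambda>x. x \<in> J"] by blast
  have "\<exists>x \<in> set (x # ys). x \<in> J" using q(2) by simp
  then obtain us x' vs where ys: "x # ys = us @ x' # vs" "x' \<in> J" "\<forall>y \<in> set vs. y \<notin> J"
    using split_list_last_prop[of "x # ys" "\<lambda>x. x \<in> J"] by blast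
  have "xs \<noteq> []" using q assms(4) by auto
  then obtain xs' y where xs: "xs = xs' @ [y]" by (metis rev_exhaust)
  have "vs \<noteq> []" using q ys assms(5) by auto
  then obtain y' vs' where vs: "vs = y' # vs'" by (cases vs) auto
  have q': "q = xs' @ y # us @ x' # y' # vs'" using q ys xs vs by simp
  have "R y x" using assms(2) unfolding q(1) xs by (auto simp: successively_append_iff)
  then have "y = c" using q xs by (intro out[of x y]) auto
  moreover have "R x' y'" using assms(2) unfolding q' by (auto simp: successively_append_iff successively_Cons)
  then have "y' = c" using q' ys vs by (intro out[of x' y']) auto
  ultimately show False using assms(1) unfolding q' by simp
qed

text \<open>This extracts the contributions of \<open>V\<close> and of the sets \<open>F j\<close> as remainder and quotient modulo \<open>N\<close>.\<close>

lemma binary_balance: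
  fixes F :: "nat \<Rightarrow> 'v set"
  assumes fin: "finite X" "finite Y" and disj: "X \<inter> Y = {}"
    and C: "C \<inter> (X \<union> Y) \<subseteq> V \<union> (\<Union>j<n. F j)" and V: "V \<subseteq> C" "\<And>j. j < n \<Longrightarrow> F j \<inter> V = {}"
    and F: "\<And>i j. i < n \<Longrightarrow> j < n \<Longrightarrow> i \<noteq> j \<Longrightarrow> F i \<inter> F j = {}"
    and card_F: "\<And>j. j < n \<Longrightarrow> card (F j \<inter> C) = N * 2 ^ j"
    and small: "card (V \<inter> X) < N" "card (V \<inter> Y) < N"
    and intact: "\<And>j. j < n \<Longrightarrow> F j \<subseteq> X \<or> F j \<subseteq> Y \<or> F j \<inter> (X \<union> Y) = {}"
    and eq: "card (X \<inter> C) = card (Y \<inter> C)"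
  shows "(\<forall>j<n. F j \<inter> (X \<union> Y) = {}) \<and> card (V \<inter> X) = card (V \<inter> Y)"
proof -
  \<comment> \<open>\<open>J Z\<close> collects the indices of the sets inside \<open>Z\<close>; the
    sum of the corresponding powers of two is \<open>set_encode (J Z)\<close>.\<close>
  define J where "J = (\<lambda>Z. {j. j < n \<and> F j \<subseteq> Z})"
  have finJ: "finite (J Z)" for Z by (simp add: J_def)
  have nonempty: "F j \<noteq> {}" if "j < n" for j
    using card_F[OF that] small by auto
  have count: "card (Z \<inter> C) = card (V \<inter> Z) + N * set_encode (J Z)"
    if Z: "finite Z" "Z \<subseteq> X \<union> Y" and int: "\<And>j. j < n \<Longrightarrow> F j \<subseteq> Z \<or> F j \<inter> Z = {}" for Z
  proof -
    have "Z \<inter> C = (V \<inter> Z) \<union> (\<Union>j\<in>J Z. F j \<inter> C)"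
    proof (intro equalityI subsetI)
      fix x assume x: "x \<in> Z \<inter> C"
      show "x \<in> (V \<inter> Z) \<union> (\<Union>j\<in>J Z. F j \<inter> C)"
      proof (cases "x \<in> V")
        case False
        then obtain j where "j < n" "x \<in> F j" using x C Z(2) by auto
        moreover have "F j \<subseteq> Z" using int[OF \<open>j < n\<close>] x \<open>x \<in> F j\<close> by auto
        ultimately show ?thesis using x by (auto simp: J_def)
      qed (use x in auto)
    next
      fix x assume "x \<in> (V \<inter> Z) \<union> (\<Union>j\<in>J Z. F j \<inter> C)"
      then show "x \<in> Z \<inter> C" using V(1) by (auto simp: J_def)
    qed
    also have "card \<dots> = card (V \<inter> Z) + card (\<Union>j\<in>J Z. F j \<inter> C)"
    proof (rule card_Un_disjoint)
      show "finite (\<Union>j\<in>J Z. F j \<inter> C)"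
        by (rule finite_subset[OF _ Z(1)]) (auto simp: J_def)
      show "(V \<inter> Z) \<inter> (\<Union>j\<in>J Z. F j \<inter> C) = {}"
        using V(2) by (auto simp: J_def)
    qed (use Z(1) in auto)
    also have "card (\<Union>j\<in>J Z. F j \<inter> C) = (\<Sum>j\<in>J Z. card (F j \<inter> C))"
    proof (rule card_UN_disjoint[OF finJ])
      show "\<forall>j\<in>J Z. finite (F j \<inter> C)"
        using Z(1) by (auto simp: J_def intro: finite_subset)
      show "\<forall>i\<in>J Z. \<forall>j\<in>J Z. i \<noteq> j \<longrightarrow> (F i \<inter> C) \<inter> (F j \<inter> C) = {}"
        using F by (fastforce simp: J_def)
    qed
    also have "\<dots> = N * set_encode (J Z)"
      unfolding set_encode_def sum_distrib_left by (intro sum.cong) (auto simp: J_def card_F)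
    finally show ?thesis .
  qed
  have intX: "F j \<subseteq> X \<or> F j \<inter> X = {}" and intY: "F j \<subseteq> Y \<or> F j \<inter> Y = {}" if "j < n" for j
    using intact[OF that] disj by blast+
  have sums: "card (V \<inter> X) + N * set_encode (J X) = card (V \<inter> Y) + N * set_encode (J Y)"
    using count[OF fin(1) Un_upper1 intX] count[OF fin(2) Un_upper2 intY] eq by simp
  have 1: "card (V \<inter> X) = card (V \<inter> Y)"
    using arg_cong[OF sums, of "\<lambda>k. k mod N"] small by simp
  then have "set_encode (J X) = set_encode (J Y)"
    using sums small by simp
  \<comment> \<open>Binary expansions are unique. A common index would give a nonempty set inside
    both \<open>X\<close> and \<open>Y\<close>, which are disjoint, so there is no index at
    all.\<close>
  then have "J X = J Y"
    using inj_on_set_encode finJ by (auto dest: inj_onD)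
  have "F j \<inter> (X \<union> Y) = {}" if "j < n" for j
  proof (rule ccontr)
    assume "F j \<inter> (X \<union> Y) \<noteq> {}"
    with intact[OF that] have "F j \<subseteq> X \<or> F j \<subseteq> Y" by blast
    with \<open>J X = J Y\<close> that have "F j \<subseteq> X \<inter> Y" unfolding J_def by blast
    with disj nonempty[OF that] show False by blast
  qed
  with 1 show ?thesis by blast
qed

section \<open>Colouring subdivided edges\<close>

text \<open>
  The sizes of the two segments of each type \<open>c < 3\<close> run through the powers \<open>2 ^ (2 * i)\<close> and
  \<open>2 ^ (2 * i + 1)\<close> as \<open>i\<close> runs through the edges. For the middle segments the factor \<open>2 * m + 1\<close>
  exceeds the number of end vertices of \<open>m\<close> edges, whose colour these segments share.
\<close>

definition seg_size :: "nat \<Rightarrow> nat \<Rightarrow> nat \<Rightarrow> nat" where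
  "seg_size m i k = (if k < 3 then 4 ^ i else if k = 3 then (2 * m + 1) * 2 ^ i else 2 * 4 ^ i)"

text \<open>Segments are cut at zeros of the word, so that segment \<open>k\<close> contains exactly
  \<open>seg_size m i k\<close> zeros. The leading 1 skips the zero at position 0, which is the
  place of an end vertex of the edge.\<close>

definition seg_start :: "nat \<Rightarrow> nat \<Rightarrow> nat \<Rightarrow> nat" where
  "seg_start m i k = zero_pos (1 + (\<Sum>j<k. seg_size m i j))"

abbreviation edge_end :: "nat \<Rightarrow> nat \<Rightarrow> nat" where
  "edge_end m i \<equiv> seg_start m i 7"

definition seg :: "nat \<Rightarrow> nat \<Rightarrow> nat \<Rightarrow> nat" where
  "seg m i t = (LEAST k. t < seg_start m i (Suc k))"

definition seg_type :: "nat \<Rightarrow> nat" where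
  "seg_type k = (if k \<le> 3 then k else 6 - k)"

lemma seg_size_pos: "0 < seg_size m i k"
  by (simp add: seg_size_def)

lemma seg_start_less_iff [simp]: "seg_start m i j < seg_start m i k \<longleftrightarrow> j < k"
proof -
  have "strict_mono (\<lambda>k. \<Sum>j<k. seg_size m i j)"
    by (simp add: strict_mono_Suc_iff seg_size_pos)
  from strict_mono_less[OF this] show ?thesis by (simp add: seg_start_def)
qed

lemma seg_start_le_iff [simp]: "seg_start m i j \<le> seg_start m i k \<longleftrightarrow> j \<le> k"
  by (metis linorder_not_le seg_start_less_iff)

lemma seg_start_pos [simp]: "0 < seg_start m i k"
  using le_zero_pos[of "1 + (\<Sum>j<k. seg_size m i j)"] by (simp add: seg_start_def)

lemma seg_eq: "seg_start m i k \<le> t \<Longrightarrow> t < seg_start m i (Suc k) \<Longrightarrow> seg m i t = k"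
  unfolding seg_def
proof (rule Least_equality)
  fix j assume "seg_start m i k \<le> t" "t < seg_start m i (Suc j)"
  then have "seg_start m i k < seg_start m i (Suc j)" by (rule le_less_trans)
  then show "k \<le> j" by simp
qed

lemma seg_bounds:
  assumes "seg_start m i 0 \<le> t" "t < edge_end m i"
  shows "seg m i t < 7" "seg_start m i (seg m i t) \<le> t" "t < seg_start m i (Suc (seg m i t))"
proof -
  have ex: "t < seg_start m i (Suc 6)" using assms(2) by (simp add: eval_nat_numeral)
  show "t < seg_start m i (Suc (seg m i t))"
    unfolding seg_def using ex by (rule LeastI)
  have "seg m i t \<le> 6" unfolding seg_def using ex by (rule Least_le)
  then show "seg m i t < 7" by simp
  show "seg_start m i (seg m i t) \<le> t"
  proof (cases "seg m i t")
    case (Suc k)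
    then have "\<not> t < seg_start m i (Suc k)"
      using not_less_Least[of k "\<lambda>k. t < seg_start m i (Suc k)"] by (simp add: seg_def)
    with Suc show ?thesis by simp
  qed (use assms in simp)
qed

lemma zero_ge_seg_start_0: "word t = 0 \<Longrightarrow> 0 < t \<Longrightarrow> seg_start m i 0 \<le> t"
proof -
  assume t: "word t = 0" "0 < t"
  then obtain k where k: "t = zero_pos k" using zero_pos_surj by blast
  have "word 0 = 0" by (simp add: word.simps)
  then obtain j where j: "0 = zero_pos j" using zero_pos_surj by blast
  have "zero_pos j < zero_pos k" using t(2) j k by simp
  then show ?thesis by (simp add: k seg_start_def)
qed

lemma card_zeros_seg:
  "card {t. seg_start m i k \<le> t \<and> t < seg_start m i (Suc k) \<and> word t = 0} = seg_size m i k"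
  by (simp add: seg_start_def card_zeros_between)

text \<open>The type ignores the letter: an end of one of the two halves of a path interrupts the
  stretch around it even if its own letter is not 0.\<close>

fun vertex_type :: "nat \<Rightarrow> 'a + nat \<Rightarrow> nat" where
  "vertex_type m (Inl v) = 3"
| "vertex_type m (Inr n) = (let (i, t) = prod_decode n in seg_type (seg m i t))"

fun colour :: "nat \<Rightarrow> 'a + nat \<Rightarrow> nat" where
  "colour m (Inl v) = 3"
| "colour m (Inr n) = (let (i, t) = prod_decode n in
     if word t = 0 then seg_type (seg m i t) else word t + 3)"

lemma seg_type_le: "seg_type k \<le> 3"
  by (auto simp: seg_type_def)

lemma colour_less_8: "colour m x < 8"
proof (cases x)
  case (Inr n)
  obtain i t where "prod_decode n = (i, t)" by fastforce
  then show ?thesis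
    using Inr word_lt_5[of t] seg_type_le[of "seg m i t"] by simp
qed simp

section \<open>Walks along subdivided edges\<close>

locale subdivided_edges =
  fixes m :: nat and a b :: "nat \<Rightarrow> 'a"
begin

definition division :: "nat \<Rightarrow> nat \<Rightarrow> 'a + nat" where
  "division i s = Inr (prod_encode (i, s))"

definition point :: "nat \<Rightarrow> nat \<Rightarrow> 'a + nat" where
  "point i s = (if s = 0 then Inl (a i) else if s = edge_end m i then Inl (b i) else division i s)"

definition adj :: "'a + nat \<Rightarrow> 'a + nat \<Rightarrow> bool" where
  "adj x y \<longleftrightarrow> (\<exists>i<m. \<exists>s<edge_end m i. {x, y} = {point i s, point i (Suc s)})"

definition interval :: "nat \<Rightarrow> nat \<Rightarrow> nat \<Rightarrow> ('a + nat) set" where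
  "interval i l r = division i ` {l..<r}"

definition stretch :: "nat \<Rightarrow> nat \<Rightarrow> ('a + nat) set" where
  "stretch i k = interval i (seg_start m i k) (seg_start m i (Suc k))"

lemma division_eq_iff [simp]: "division i s = division j t \<longleftrightarrow> i = j \<and> s = t"
  by (simp add: division_def)

lemma division_neq_Inl [simp]: "division i s \<noteq> Inl v" "Inl v \<noteq> division i s"
  by (simp_all add: division_def)

lemma point_eq_division: "0 < s \<Longrightarrow> s < edge_end m i \<Longrightarrow> point i s = division i s"
  by (simp add: point_def)

lemma point_eq_division_iff:
  "s \<le> edge_end m i \<Longrightarrow> point i s = division j t \<longleftrightarrow> j = i \<and> t = s \<and> 0 < s \<and> s < edge_end m i"
  by (auto simp: point_def)

lemma vertex_type_division [simp]: "vertex_type m (division i t) = seg_type (seg m i t)"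
  and colour_division [simp]:
    "colour m (division i t) = (if word t = 0 then seg_type (seg m i t) else word t + 3)"
  by (simp_all add: division_def)

lemma adj_sym: "adj x y \<longleftrightarrow> adj y x"
  by (simp add: adj_def insert_commute)

lemma adj_division:
  assumes "adj x y" "x = division i s"
  shows "0 < s \<and> s < edge_end m i \<and> i < m \<and> (y = point i (s - 1) \<or> y = point i (Suc s))"
proof -
  obtain j r where jr: "j < m" "r < edge_end m j" "{x, y} = {point j r, point j (Suc r)}"
    using assms(1) by (auto simp: adj_def)
  then consider "x = point j r" "y = point j (Suc r)" | "x = point j (Suc r)" "y = point j r"
    by (auto simp: doubleton_eq_iff)
  then show ?thesis
    using jr(1,2) assms(2) point_eq_division_iff[of r j i s] point_eq_division_iff[of "Suc r" j i s]
    by cases auto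
qed

lemma interval_boundary:
  assumes "0 < l" "r \<le> edge_end m i" "x \<in> interval i l r" "adj x y" "y \<notin> interval i l r"
  shows "y = point i (l - 1) \<or> y = point i r"
proof -
  obtain s where s: "x = division i s" "l \<le> s" "s < r"
    using assms(3) by (auto simp: interval_def)
  have y: "y = point i (s - 1) \<or> y = point i (Suc s)"
    using adj_division[OF assms(4) s(1)] by simp
  have inner: "point i t \<in> interval i l r" if "l \<le> t" "t < r" for t
    using that assms(1,2) by (auto simp: interval_def point_def)
  from y show ?thesis
  proof
    assume "y = point i (s - 1)"
    moreover have "s - 1 = l - 1 \<or> l \<le> s - 1 \<and> s - 1 < r" using s by linarith
    ultimately show ?thesis using inner assms(5) by metis
  next
    assume "y = point i (Suc s)"
    moreover have "Suc s = r \<or> l \<le> Suc s \<and> Suc s < r" using s by linarith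
    ultimately show ?thesis using inner assms(5) by metis
  qed
qed

text \<open>If the path misses one vertex of the interval but visits another, the part of the
  interval on the visited side has a single exit left, while a path with both ends outside needs
  two.\<close>

lemma interval_intact:
  assumes q: "distinct q" "successively adj q" and ends: "hd q \<notin> interval i l r" "last q \<notin> interval i l r"
    and lr: "0 < l" "r \<le> edge_end m i"
  shows "interval i l r \<subseteq> set q \<or> interval i l r \<inter> set q = {}"
proof (rule ccontr)
  assume "\<not> ?thesis"
  then obtain s s' where s: "l \<le> s" "s < r" "division i s \<in> set q"
    and s': "l \<le> s'" "s' < r" "division i s' \<notin> set q"
    by (auto simp: interval_def)
  then have "s \<noteq> s'" by auto
  then consider "s < s'" | "s' < s" by linarith
  then show False
  proof cases
    case 1
    show False
    proof (rule path_cut_point[OF q])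
      show "set q \<inter> interval i l s' \<noteq> {}" using s 1 by (auto simp: interval_def)
      show "hd q \<notin> interval i l s'" "last q \<notin> interval i l s'"
        using ends s'(2) by (auto simp: interval_def)
      fix x y assume "x \<in> set q \<inter> interval i l s'" "y \<in> set q - interval i l s'" "adj x y \<or> adj y x"
      then have "y = point i (l - 1) \<or> y = point i s'"
        using lr s'(2) by (intro interval_boundary) (auto simp: adj_sym)
      moreover have "point i s' \<notin> set q"
        using s' lr by (simp add: point_eq_division)
      ultimately show "y = point i (l - 1)" using \<open>y \<in> set q - interval i l s'\<close> by auto
    qed
  next
    case 2
    show False
    proof (rule path_cut_point[OF q])
      show "set q \<inter> interval i (Suc s') r \<noteq> {}" using s 2 by (auto simp: interval_def)
      show "hd q \<notin> interval i (Suc s') r" "last q \<notin> interval i (Suc s') r"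
        using ends s'(1) by (auto simp: interval_def)
      fix x y assume "x \<in> set q \<inter> interval i (Suc s') r" "y \<in> set q - interval i (Suc s') r" "adj x y \<or> adj y x"
      then have "y = point i (Suc s' - 1) \<or> y = point i r"
        using lr by (intro interval_boundary) (auto simp: adj_sym)
      moreover have "point i s' \<notin> set q"
        using s' lr by (simp add: point_eq_division)
      ultimately show "y = point i r" using \<open>y \<in> set q - interval i (Suc s') r\<close> by auto
    qed
  qed
qed

lemma interval_cut:
  assumes q: "successively adj q" and x: "x \<in> set q" "x \<in> interval i l r" and y: "y \<in> set q" "y \<notin> interval i l r"
    and lr: "0 < l" "r \<le> edge_end m i"
  shows "point i (l - 1) \<in> set q \<or> point i r \<in> set q"
proof (rule ccontr)
  assume *: "\<not> ?thesis"
  have "set q \<subseteq> interval i l r \<or> set q \<inter> interval i l r = {}"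
  proof (rule walk_cut[OF q])
    fix x y assume "x \<in> set q \<inter> interval i l r" "y \<in> set q - interval i l r"
    with * show "\<not> adj x y \<and> \<not> adj y x"
      using interval_boundary[OF lr, of x y] by (auto simp: adj_sym)
  qed
  with x y show False by blast
qed

text \<open>Two missing vertices, one on each side of \<open>t\<close>, would enclose an interval
  that the walk cannot leave, although it also visits the original vertex \<open>v\<close>.\<close>

lemma initial_or_final_segment:
  assumes q: "successively adj q" and t: "division i t \<in> set q" "0 < t" "t < edge_end m i" and v: "Inl v \<in> set q"
  shows "(\<forall>s. 0 < s \<and> s \<le> t \<longrightarrow> division i s \<in> set q) \<or>
    (\<forall>s. t \<le> s \<and> s < edge_end m i \<longrightarrow> division i s \<in> set q)"
proof (rule ccontr)
  assume "\<not> ?thesis"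
  then obtain s1 s2 where s: "0 < s1" "s1 \<le> t" "division i s1 \<notin> set q"
    "t \<le> s2" "s2 < edge_end m i" "division i s2 \<notin> set q"
    by blast
  then have "s1 < t" "t < s2" using t(1) by (metis le_neq_implies_less)+
  have "point i (Suc s1 - 1) \<in> set q \<or> point i s2 \<in> set q"
    using s \<open>s1 < t\<close> \<open>t < s2\<close> by (intro interval_cut[OF q t(1) _ v]) (auto simp: interval_def)
  then show False using s t by (simp add: point_eq_division)
qed

text \<open>With an inner vertex removed from every edge, the graph falls apart into stars around
  the original vertices, and a walk stays in one star.\<close>

lemma branch_vertices_eq:
  assumes q: "successively adj q" and v: "Inl v \<in> set q" "Inl w \<in> set q"
    and miss: "\<And>i. i < m \<Longrightarrow> 0 < c i \<and> c i < edge_end m i \<and> division i (c i) \<notin> set q"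
  shows "v = w"
proof -
  \<comment> \<open>\<open>J\<close> is the star around \<open>v\<close>: each edge is split at
    \<open>c i\<close> and each half belongs to its end. The vertex at \<open>c i\<close> falls to
    the half of \<open>b i\<close>, but it is off the walk.\<close>
  define J where "J = insert (Inl v) {division i s | i s. i < m \<and> 0 < s \<and> s < edge_end m i \<and>
     (if s < c i then a i else b i) = v}"
  have J: "point i s \<in> J \<longleftrightarrow> (if s < c i then a i else b i) = v"
    if "i < m" "s \<le> edge_end m i" for i s
    using that miss[OF that(1)] by (auto simp: J_def point_def)
  have "set q \<subseteq> J \<or> set q \<inter> J = {}"
  proof (rule walk_cut[OF q])
    fix x y assume xy: "x \<in> set q \<inter> J" "y \<in> set q - J"
    have False if "adj x y"
    proof -
      obtain i s where i: "i < m" "s < edge_end m i" "{x, y} = {point i s, point i (Suc s)}"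
        using \<open>adj x y\<close> by (auto simp: adj_def)
      have "point i (c i) \<notin> set q"
        using miss[OF i(1)] by (simp add: point_eq_division)
      moreover have "{point i s, point i (Suc s)} \<subseteq> set q"
        unfolding i(3)[symmetric] using xy by blast
      ultimately have "s \<noteq> c i" "Suc s \<noteq> c i" by auto
      then have "s < c i \<longleftrightarrow> Suc s < c i" by linarith
      then have "point i s \<in> J \<longleftrightarrow> point i (Suc s) \<in> J"
        using J[of i s] J[of i "Suc s"] i(1,2) by simp
      then show False using i(3) xy by (auto simp: doubleton_eq_iff)
    qed
    then show "\<not> adj x y \<and> \<not> adj y x" by (auto simp: adj_sym)
  qed
  then show ?thesis using v by (auto simp: J_def)
qed

lemma stretch_vertex_type: "x \<in> stretch i k \<Longrightarrow> vertex_type m x = seg_type k"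
  by (auto simp: stretch_def interval_def seg_eq)

lemma stretch_disjoint:
  assumes "(i, k) \<noteq> (i', k')"
  shows "stretch i k \<inter> stretch i' k' = {}"
proof (rule ccontr)
  assume "\<not> ?thesis"
  then obtain t where "division i t \<in> stretch i k" "division i t \<in> stretch i' k'"
    by (auto simp: stretch_def interval_def)
  then have "i = i'" "seg m i t = k" "seg m i' t = k'"
    by (auto simp: stretch_def interval_def seg_eq)
  with assms show False by simp
qed

lemma card_stretch_colour: "card (stretch i k \<inter> {x. colour m x = seg_type k}) = seg_size m i k"
proof -
  have "stretch i k \<inter> {x. colour m x = seg_type k} =
      division i ` {t. seg_start m i k \<le> t \<and> t < seg_start m i (Suc k) \<and> word t = 0}"
    using seg_type_le[of k] by (auto simp: stretch_def interval_def seg_eq split: if_splits)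
  then show ?thesis
    by (simp add: card_image inj_on_def card_zeros_seg)
qed

text \<open>On division vertices the colours up to 3 stand for the letter 0, and the positive zeros
  begin with segment 0, so none of them precedes the seven segments.\<close>

lemma coloured_in_stretch:
  assumes "colour m (division i t) \<le> 3" "0 < t" "t < edge_end m i"
  shows "division i t \<in> stretch i (seg m i t)" "seg m i t < 7" "colour m (division i t) = seg_type (seg m i t)"
proof -
  have "word t = 0" using assms(1) by (auto split: if_splits)
  then have "seg_start m i 0 \<le> t" using assms(2) by (rule zero_ge_seg_start_0)
  with seg_bounds[OF this assms(3)] \<open>word t = 0\<close>
  show "division i t \<in> stretch i (seg m i t)" "seg m i t < 7"
    "colour m (division i t) = seg_type (seg m i t)"
    by (auto simp: stretch_def interval_def)
qed

lemma adj_cases: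
  assumes "adj x y"
  obtains (branch) i where "i < m" "x = Inl (a i) \<or> x = Inl (b i)"
  | (division) i t where "i < m" "0 < t" "t < edge_end m i" "x = division i t"
proof (cases x)
  case (Inl v)
  obtain i s where i: "i < m" "s < edge_end m i" "{x, y} = {point i s, point i (Suc s)}"
    using assms by (auto simp: adj_def)
  then have "x = point i s \<or> x = point i (Suc s)" by blast
  then show ?thesis using branch[OF i(1)] Inl by (auto simp: point_def split: if_splits)
next
  case (Inr n)
  then have "x = division (fst (prod_decode n)) (snd (prod_decode n))"
    by (simp add: division_def)
  then show ?thesis using adj_division[OF assms] division by blast
qed

end

section \<open>Paths inside a single edge\<close>

lemma walk_neighbour:
  "successively R q \<Longrightarrow> 2 \<le> length q \<Longrightarrow> x \<in> set q \<Longrightarrow> \<exists>y. R x y \<or> R y x"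
proof (induction q rule: induct_list012)
  case (3 y z zs)
  then show ?case by (cases zs) auto
qed auto

lemma count_map_distinct:
  "distinct xs \<Longrightarrow> count (mset (map f xs)) c = card {x \<in> set xs. f x = c}"
proof (induction xs)
  case (Cons y xs)
  have "{x \<in> set (y # xs). f x = c} =
      (if f y = c then insert y {x \<in> set xs. f x = c} else {x \<in> set xs. f x = c})"
    by auto
  with Cons show ?case by simp
qed simp

lemma convex_nat_set:
  fixes T :: "nat set"
  assumes "finite T" "T \<noteq> {}" "\<And>x y z. x \<in> T \<Longrightarrow> y \<in> T \<Longrightarrow> x < z \<Longrightarrow> z < y \<Longrightarrow> z \<in> T"
  shows "\<exists>l r. l < r \<and> T = {l..<r}"
proof (intro exI conjI)
  have minmax: "Min T \<in> T" "Max T \<in> T" using assms(1,2) by auto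
  show "Min T < Suc (Max T)" using minmax assms(1) by (simp add: le_imp_less_Suc)
  show "T = {Min T..<Suc (Max T)}"
  proof (intro equalityI subsetI)
    fix z assume "z \<in> {Min T..<Suc (Max T)}"
    then have "z = Min T \<or> z = Max T \<or> Min T < z \<and> z < Max T" by auto
    then show "z \<in> T" using minmax assms(3) by blast
  qed (use assms(1) in \<open>auto simp: less_Suc_eq_le\<close>)
qed

text \<open>Disjointness and the convexity of the union make the intervals adjacent. Either may come
  first, since an edge can be traversed in both directions.\<close>

lemma word_intervals_unbalanced:
  assumes "l < r" "l' < r'" "{l..<r} \<inter> {l'..<r'} = {}"
    and convex: "\<And>x y z. x \<in> {l..<r} \<union> {l'..<r'} \<Longrightarrow> y \<in> {l..<r} \<union> {l'..<r'} \<Longrightarrow> x < z \<Longrightarrow> z < y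
      \<Longrightarrow> z \<in> {l..<r} \<union> {l'..<r'}"
  shows "\<exists>c<5. card {t \<in> {l..<r}. word t = c} \<noteq> card {t \<in> {l'..<r'}. word t = c}"
proof -
  have adjacent: "y = x'" if "x < y" "x' < y'" "y \<le> x'" "{x..<y} \<union> {x'..<y'} = {l..<r} \<union> {l'..<r'}" for x y x' y'
  proof (rule ccontr)
    assume "y \<noteq> x'"
    then have "y \<in> {l..<r} \<union> {l'..<r'}"
      using that by (intro convex[of x x' y]) (auto simp flip: that(4))
    with that \<open>y \<noteq> x'\<close> show False by (auto simp flip: that(4))
  qed
  have "r \<le> l' \<or> r' \<le> l"
  proof (rule ccontr)
    assume "\<not> ?thesis"
    then have "max l l' \<in> {l..<r} \<inter> {l'..<r'}" using assms(1,2) by auto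
    with assms(3) show False by simp
  qed
  then show ?thesis
  proof
    assume "r \<le> l'"
    with adjacent[of l r l' r'] assms(1,2) have "r = l'" by simp
    with word_anagram_free[of l r r'] assms(1,2) show ?thesis by simp
  next
    assume "r' \<le> l"
    with adjacent[of l' r' l r] assms(1,2) have "r' = l" by (simp add: Un_commute)
    with word_anagram_free[of l' l r] assms(1,2) show ?thesis by metis
  qed
qed

context subdivided_edges
begin

text \<open>Such a path stays inside one edge, because leaving it means passing one of its ends.
  Merging the colours 0 to 3 into the letter 0 turns an anagram of colours into an anagram in the
  word.\<close>

lemma split_in_single_edge:
  assumes path: "distinct (p1 @ p2)" "successively adj (p1 @ p2)" and ne: "p1 \<noteq> []" "p2 \<noteq> []"
    and no_branch: "\<And>v. Inl v \<notin> set (p1 @ p2)"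
  shows "mset (map (colour m) p1) \<noteq> mset (map (colour m) p2)"
proof
  assume eq: "mset (map (colour m) p1) = mset (map (colour m) p2)"
  define p where "p = p1 @ p2"
  \<comment> \<open>With at least two vertices on the path, the first one has a neighbour and hence
    lies on some edge \<open>i\<close>; the type of vertices also has elements on no edge.\<close>
  have "2 \<le> length p" using ne by (cases p1; cases p2) (auto simp: p_def)
  moreover have "hd p1 \<in> set p" using ne by (simp add: p_def)
  ultimately obtain y where "adj (hd p1) y"
    using walk_neighbour[of adj p "hd p1"] path(2) by (auto simp: p_def adj_sym)
  then obtain i t where t: "i < m" "0 < t" "t < edge_end m i" "hd p1 = division i t"
    using no_branch \<open>hd p1 \<in> set p\<close> by (cases rule: adj_cases) (auto simp: p_def)
  have no_point: "point i 0 \<notin> set q" "point i (edge_end m i) \<notin> set q" if "set q \<subseteq> set p" for q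
    using no_branch that by (auto simp: point_def p_def)
  have subset: "set p \<subseteq> interval i 1 (edge_end m i)"
  proof
    fix z assume "z \<in> set p"
    show "z \<in> interval i 1 (edge_end m i)"
    proof (rule ccontr)
      assume "z \<notin> interval i 1 (edge_end m i)"
      moreover have "hd p1 \<in> interval i 1 (edge_end m i)" using t by (auto simp: interval_def)
      ultimately have "point i (1 - 1) \<in> set p \<or> point i (edge_end m i) \<in> set p"
        using \<open>hd p1 \<in> set p\<close> \<open>z \<in> set p\<close> path(2) by (intro interval_cut) (auto simp: p_def)
      with no_point[of p] show False by simp
    qed
  qed
  define T where "T = (\<lambda>q. {s. division i s \<in> set q})"
  have set_eq: "set q = division i ` T q" if "set q \<subseteq> set p" for q
    using that subset by (auto simp: T_def interval_def)
  have T_bounds: "0 < s" "s < edge_end m i" if "s \<in> T p" for s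
    using that subset by (auto simp: T_def interval_def)
  have fin: "finite (T q)" if "set q \<subseteq> set p" for q
    by (rule finite_subset[of _ "{..<edge_end m i}"]) (use T_bounds that in \<open>auto simp: T_def\<close>)
  have convex: "z \<in> T q" if q: "set q \<subseteq> set p" "successively adj q"
    and xyz: "x \<in> T q" "y \<in> T q" "x < z" "z < y" for q x y z
  proof -
    have "x \<in> T p" "y \<in> T p" using q(1) xyz by (auto simp: T_def)
    \<comment> \<open>The interval from 1 up to \<open>z\<close> contains \<open>x\<close> but not
      \<open>y\<close>, so the walk passes one of its two outer neighbours; the first of them is an
      original vertex.\<close>
    then have "point i (1 - 1) \<in> set q \<or> point i z \<in> set q"
      using xyz T_bounds[of x] T_bounds[of y]
      by (intro interval_cut[OF q(2), of "division i x" _ _ _ "division i y"]) (auto simp: T_def interval_def)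
    moreover have "point i z = division i z"
      using xyz T_bounds[OF \<open>x \<in> T p\<close>] T_bounds[OF \<open>y \<in> T p\<close>] by (simp add: point_eq_division)
    ultimately show ?thesis using no_point[OF q(1)] by (auto simp: T_def)
  qed
  have sub: "set p1 \<subseteq> set p" "set p2 \<subseteq> set p" by (auto simp: p_def)
  have walks: "successively adj p1" "successively adj p2" "successively adj p"
    using path(2) by (auto simp: successively_append_iff p_def)
  have nonempty: "T p1 \<noteq> {}" "T p2 \<noteq> {}"
    using ne set_eq[OF sub(1)] set_eq[OF sub(2)] by auto
  have "\<exists>l r. l < r \<and> T p1 = {l..<r}"
    by (rule convex_nat_set[OF fin[OF sub(1)] nonempty(1)]) (rule convex[OF sub(1) walks(1)])
  then obtain l r where T1: "l < r" "T p1 = {l..<r}"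
    by blast
  have "\<exists>l r. l < r \<and> T p2 = {l..<r}"
    by (rule convex_nat_set[OF fin[OF sub(2)] nonempty(2)]) (rule convex[OF sub(2) walks(2)])
  then obtain l' r' where T2: "l' < r'" "T p2 = {l'..<r'}"
    by blast
  have Tp: "T p = T p1 \<union> T p2" by (auto simp: T_def p_def)
  have "\<exists>c<5. card {t \<in> T p1. word t = c} \<noteq> card {t \<in> T p2. word t = c}"
    unfolding T1(2) T2(2)
  proof (rule word_intervals_unbalanced[OF T1(1) T2(1)], unfold T1(2)[symmetric] T2(2)[symmetric] Tp[symmetric])
    show "T p1 \<inter> T p2 = {}" using path(1) by (auto simp: T_def)
  qed (rule convex[OF order_refl walks(3)])
  then obtain c where c: "c < 5" "card {t \<in> T p1. word t = c} \<noteq> card {t \<in> T p2. word t = c}"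
    by blast
  define g where "g = (\<lambda>c :: nat. if c < 4 then 0 else c - 3)"
  have g: "g (colour m (division i s)) = word s" for s
    using seg_type_le[of "seg m i s"] by (simp add: g_def)
  have card_T: "count (mset (map (g \<circ> colour m) q)) c = card {t \<in> T q. word t = c}"
    if "set q \<subseteq> set p" "distinct q" for q
  proof -
    have "{x \<in> set q. (g \<circ> colour m) x = c} = division i ` {t \<in> T q. word t = c}"
      unfolding set_eq[OF that(1)] by (auto simp: g simp del: colour_division)
    then show ?thesis
      unfolding count_map_distinct[OF that(2)] by (simp add: card_image inj_on_def)
  qed
  have "mset (map (g \<circ> colour m) p1) = mset (map (g \<circ> colour m) p2)"
    using arg_cong[OF eq, of "image_mset g"] by (simp add: multiset.map_comp)
  with card_T[OF sub(1)] card_T[OF sub(2)] c(2) path(1) show False by simp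
qed


lemma split_at_branch_vertex:
  assumes path: "distinct (p1 @ p2)" "successively adj (p1 @ p2)" and ne: "p1 \<noteq> []" "p2 \<noteq> []"
    and branch: "Inl v \<in> set (p1 @ p2)"
  shows "mset (map (colour m) p1) \<noteq> mset (map (colour m) p2)"
proof
  assume eq: "mset (map (colour m) p1) = mset (map (colour m) p2)"
  define P where "P = {hd p1, last p1, last p2}"
  define X where "X = set p1 \<union> set p2"
  have P_X: "P \<subseteq> X" using ne by (auto simp: P_def X_def)
  have X: "set (p1 @ p2) = X" by (simp add: X_def)
  have disj: "set p1 \<inter> set p2 = {}" using path(1) by simp
  have intact: "stretch i k \<subseteq> set p1 \<or> stretch i k \<subseteq> set p2 \<or> stretch i k \<inter> X = {}"
    if "k < 7" "stretch i k \<inter> P = {}" for i k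
  proof -
    have "seg_start m i (Suc k) \<le> edge_end m i" using that(1) by simp
    moreover have "hd p1 \<notin> stretch i k" "last p1 \<notin> stretch i k" "last p2 \<notin> stretch i k"
      using that(2) by (auto simp: P_def)
    \<comment> \<open>Prefixing \<open>last p1\<close> to \<open>p2\<close> gives a path with both
      ends in \<open>P\<close>. This is how three exceptional vertices suffice, without
      \<open>hd p2\<close> as a fourth.\<close>
    moreover have "last p1 \<notin> set p2" using disj last_in_set[OF ne(1)] by blast
    then have "distinct (last p1 # p2)" "successively adj (last p1 # p2)"
      using path ne by (auto simp: successively_append_iff successively_Cons)
    moreover have "distinct p1" "successively adj p1"
      using path by (auto simp: successively_append_iff)
    ultimately have "stretch i k \<subseteq> set p1 \<or> stretch i k \<inter> set p1 = {}"
      "stretch i k \<subseteq> set (last p1 # p2) \<or> stretch i k \<inter> set (last p1 # p2) = {}"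
      using ne unfolding stretch_def by (intro interval_intact; simp)+
    with \<open>last p1 \<notin> stretch i k\<close> show ?thesis by (auto simp: X_def)
  qed
  have vertex: "(\<exists>i<m. x = Inl (a i) \<or> x = Inl (b i)) \<or>
      (\<exists>i<m. \<exists>t. 0 < t \<and> t < edge_end m i \<and> x = division i t)" if "x \<in> X" for x
  proof -
    have "2 \<le> length (p1 @ p2)" using ne by (cases p1; cases p2) auto
    moreover have "x \<in> set (p1 @ p2)" using that by (simp add: X_def)
    ultimately obtain y where "adj x y"
      using walk_neighbour[OF path(2)] adj_sym by blast
    then show ?thesis by (cases rule: adj_cases) auto
  qed
  have same_card: "card (set p1 \<inter> {x. colour m x = c}) = card (set p2 \<inter> {x. colour m x = c})" for c
  proof -
    have "card {x \<in> set p1. colour m x = c} = card {x \<in> set p2. colour m x = c}"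
      using count_map_distinct[of p1 "colour m" c] count_map_distinct[of p2 "colour m" c] path(1) eq
      by simp
    then show ?thesis by (simp add: Int_def)
  qed
  have avoid: "stretch i k \<inter> X = {}"
    if c: "c < 3" "c \<notin> vertex_type m ` P" and ik: "i < m" "k < 7" "seg_type k = c" for c i k
  proof -
    \<comment> \<open>\<open>F (2 * i)\<close> and \<open>F (2 * i + 1)\<close> are the two
      stretches of type \<open>c\<close> on edge \<open>i\<close>; their zeros number
      \<open>4 ^ i\<close> and \<open>2 * 4 ^ i\<close>, consecutive powers of two.\<close>
    define F where "F = (\<lambda>j. stretch (j div 2) (if even j then c else 6 - c))"
    have type: "seg_type (if even j then c else 6 - c) = c" for j :: nat
      using c(1) by (auto simp: seg_type_def)
    have F_ex: "\<exists>j<2 * m. stretch i k = F j" if "i < m" "k < 7" "seg_type k = c" for i k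
    proof (cases "k = c")
      case True
      then show ?thesis using that by (intro exI[of _ "2 * i"]) (auto simp: F_def)
    next
      case False
      then have "k = 6 - c" using that c(1) by (auto simp: seg_type_def split: if_splits)
      then show ?thesis using that by (intro exI[of _ "2 * i + 1"]) (auto simp: F_def)
    qed
    have "(\<forall>j<2 * m. F j \<inter> (set p1 \<union> set p2) = {}) \<and> card ({} \<inter> set p1) = card ({} \<inter> set p2)"
    proof (rule binary_balance[where C = "{x. colour m x = c}" and N = 1])
      show "{x. colour m x = c} \<inter> (set p1 \<union> set p2) \<subseteq> {} \<union> (\<Union>j<2 * m. F j)"
      proof
        fix x assume x: "x \<in> {x. colour m x = c} \<inter> (set p1 \<union> set p2)"
        with vertex[of x] c(1) obtain i t where t: "i < m" "0 < t" "t < edge_end m i" "x = division i t"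
          by (auto simp: X_def)
        have "colour m (division i t) \<le> 3" using x t(4) c(1) by simp
        note seg = coloured_in_stretch[OF this t(2,3)]
        obtain j where "j < 2 * m" "stretch i (seg m i t) = F j"
          using F_ex[OF t(1) seg(2)] seg(3) x t(4) by auto
        then show "x \<in> {} \<union> (\<Union>j<2 * m. F j)" using seg(1) t(4) by blast
      qed
      show "F i \<inter> F j = {}" if "i \<noteq> j" for i j
        unfolding F_def using that c(1)
        by (intro stretch_disjoint) (auto elim!: evenE oddE)
      show "card (F j \<inter> {x. colour m x = c}) = 1 * 2 ^ j" for j
      proof -
        have "card (F j \<inter> {x. colour m x = c}) = seg_size m (j div 2) (if even j then c else 6 - c)"
          using card_stretch_colour[of "j div 2" "if even j then c else 6 - c"] unfolding type F_def .
        also have "\<dots> = 2 ^ j"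
          using c(1) by (auto simp: seg_size_def power_mult elim!: evenE oddE)
        finally show ?thesis by simp
      qed
      show "F j \<subseteq> set p1 \<or> F j \<subseteq> set p2 \<or> F j \<inter> (set p1 \<union> set p2) = {}" for j
      proof -
        have "F j \<inter> P = {}"
          using c(2) stretch_vertex_type type[of j] unfolding F_def by fastforce
        moreover have "(if even j then c else 6 - c) < 7" using c(1) by auto
        ultimately show ?thesis
          using intact unfolding F_def X_def by blast
      qed
    qed (use disj same_card in auto)
    then show ?thesis using F_ex[OF ik] by (auto simp: X_def)
  qed
  have "\<exists>i<m. stretch i 3 \<inter> P \<noteq> {}"
  proof (rule ccontr)
    assume no_hit: "\<not> ?thesis"
    \<comment> \<open>The original vertices share the colour of the middle stretches. At most
      \<open>2 * m\<close> of them are on the path, so they make up the remainder modulo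
      \<open>2 * m + 1\<close> in the balance.\<close>
    define V where "V = {x \<in> X. x \<in> range Inl}"
    have V: "V \<subseteq> Inl ` (a ` {..<m} \<union> b ` {..<m})"
      using vertex by (fastforce simp: V_def)
    have "card V \<le> card (Inl ` (a ` {..<m} \<union> b ` {..<m}) :: ('a + nat) set)"
      by (rule card_mono[OF _ V]) simp
    also have "\<dots> \<le> card (a ` {..<m} \<union> b ` {..<m})" by (rule card_image_le) simp
    also have "\<dots> \<le> m + m"
      using card_Un_le[of "a ` {..<m}" "b ` {..<m}"] card_image_le[of "{..<m}" a] card_image_le[of "{..<m}" b]
      by simp
    finally have "card V < 2 * m + 1" by simp
    moreover have "finite V" using V by (rule finite_subset) simp
    ultimately have small: "card (V \<inter> Z) < 2 * m + 1" for Z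
      using card_mono[of V "V \<inter> Z"] by (simp add: le_less_trans)
    have balance: "(\<forall>j<m. stretch j 3 \<inter> (set p1 \<union> set p2) = {}) \<and> card (V \<inter> set p1) = card (V \<inter> set p2)"
    proof (rule binary_balance[where C = "{x. colour m x = 3}" and N = "2 * m + 1"])
      show "{x. colour m x = 3} \<inter> (set p1 \<union> set p2) \<subseteq> V \<union> (\<Union>j<m. stretch j 3)"
      proof
        fix x assume x: "x \<in> {x. colour m x = 3} \<inter> (set p1 \<union> set p2)"
        show "x \<in> V \<union> (\<Union>j<m. stretch j 3)"
        proof (cases "x \<in> V")
          case False
          with vertex[of x] x obtain i t where t: "i < m" "0 < t" "t < edge_end m i" "x = division i t"
            by (auto simp: X_def V_def)
          have "colour m (division i t) \<le> 3" using x t(4) by simp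
          note seg = coloured_in_stretch[OF this t(2,3)]
          have "seg_type (seg m i t) = 3" using seg(3) x t(4) by simp
          then have "seg m i t = 3" by (auto simp: seg_type_def split: if_splits)
          then show ?thesis using seg(1) t by auto
        qed simp
      qed
      show "V \<subseteq> {x. colour m x = 3}" by (auto simp: V_def)
      show "stretch j 3 \<inter> V = {}" for j by (auto simp: V_def stretch_def interval_def)
      show "stretch i 3 \<inter> stretch j 3 = {}" if "i \<noteq> j" for i j
        using that by (intro stretch_disjoint) simp
      show "card (stretch j 3 \<inter> {x. colour m x = 3}) = (2 * m + 1) * 2 ^ j" for j
        using card_stretch_colour[of j 3] by (simp add: seg_type_def seg_size_def)
      show "stretch j 3 \<subseteq> set p1 \<or> stretch j 3 \<subseteq> set p2 \<or> stretch j 3 \<inter> (set p1 \<union> set p2) = {}"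
        if "j < m" for j
        using intact[of 3 j] no_hit that by (auto simp: X_def)
    qed (use disj same_card small in auto)
    have "V \<noteq> {}" using branch by (auto simp: V_def X_def)
    \<comment> \<open>Both halves contain equally many original vertices, so each contains
      one.\<close>
    then have "V \<inter> set p1 \<noteq> {} \<or> V \<inter> set p2 \<noteq> {}" by (auto simp: V_def X_def)
    then have "V \<inter> set p1 \<noteq> {}" "V \<inter> set p2 \<noteq> {}"
      using balance \<open>finite V\<close> by (metis card_0_eq finite_Int)+
    then obtain v1 v2 where v: "Inl v1 \<in> set p1" "Inl v2 \<in> set p2" by (auto simp: V_def)
    \<comment> \<open>The path misses the middle stretch of every edge and thus cannot get from one
      original vertex to another.\<close>
    have "v1 = v2"
    proof (rule branch_vertices_eq[OF path(2)])
      fix i assume i: "i < m"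
      have "division i (seg_start m i 3) \<in> stretch i 3" by (simp add: stretch_def interval_def)
      then show "0 < seg_start m i 3 \<and> seg_start m i 3 < edge_end m i \<and>
          division i (seg_start m i 3) \<notin> set (p1 @ p2)"
        using balance i by auto
    qed (use v in auto)
    with v disj show False by blast
  qed
  then obtain i x where i: "i < m" "x \<in> stretch i 3" "x \<in> P" by blast
  have "vertex_type m x = 3" using stretch_vertex_type[OF i(2)] by (simp add: seg_type_def)
  have "card (vertex_type m ` P) \<le> 3"
    by (rule order_trans[OF card_image_le]) (auto simp: P_def card_insert_if)
  \<comment> \<open>\<open>P\<close> has at most three vertices and one of them has type 3, so they
    cannot cover all four types.\<close>
  have "\<exists>c<3. c \<notin> vertex_type m ` P"
  proof (rule ccontr)
    assume "\<not> ?thesis"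
    then have "{0, 1, 2, 3} \<subseteq> vertex_type m ` P"
      using i(3) \<open>vertex_type m x = 3\<close> by (auto simp del: vertex_type.simps)
    then have "card {0, 1, 2, 3 :: nat} \<le> card (vertex_type m ` P)"
      by (rule card_mono[rotated]) (simp add: P_def)
    with \<open>card (vertex_type m ` P) \<le> 3\<close> show False by simp
  qed
  then obtain c where c: "c < 3" "c \<notin> vertex_type m ` P" by blast
  obtain t where t: "x = division i t" "seg_start m i 3 \<le> t" "t < seg_start m i 4"
    using i(2) by (auto simp: stretch_def interval_def)
  have ends: "seg_start m i 4 \<le> seg_start m i (6 - c)" "seg_start m i c < seg_start m i 3"
    "seg_start m i (6 - c) < edge_end m i" "seg_start m i 4 < edge_end m i"
    using c(1) by auto
  \<comment> \<open>Since the path also contains \<open>v\<close>, it runs from \<open>x\<close> in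
    the middle stretch all the way to one end of the edge. It then meets the first vertex of stretch
    \<open>c\<close> or of stretch \<open>6 - c\<close>, contrary to \<open>avoid\<close>.\<close>
  have "(\<forall>s. 0 < s \<and> s \<le> t \<longrightarrow> division i s \<in> set (p1 @ p2)) \<or>
      (\<forall>s. t \<le> s \<and> s < edge_end m i \<longrightarrow> division i s \<in> set (p1 @ p2))"
  proof (rule initial_or_final_segment[OF path(2)])
    show "division i t \<in> set (p1 @ p2)" using i(3) t(1) P_X X by auto
    show "0 < t" using seg_start_pos[of m i 3] t(2) by linarith
    show "t < edge_end m i" using t(3) ends(4) by linarith
  qed fact
  moreover have "seg_start m i c \<le> t" "t \<le> seg_start m i (6 - c)"
    using t(2,3) ends by linarith+
  ultimately have "division i (seg_start m i c) \<in> X \<or> division i (seg_start m i (6 - c)) \<in> X"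
    using ends(3) unfolding X by (metis seg_start_pos)
  moreover have "division i (seg_start m i k) \<in> stretch i k" for k
    by (simp add: stretch_def interval_def)
  moreover have "c < 7" "6 - c < 7" "seg_type c = c" "seg_type (6 - c) = c"
    using c(1) by (auto simp: seg_type_def)
  ultimately show False
    using avoid[OF c i(1)] by blast
qed

lemma path_not_anagram:
  assumes "distinct p" "successively adj p"
  shows "\<not> anagram (map (colour m) p)"
proof
  assume "anagram (map (colour m) p)"
  then obtain W Q where WQ: "map (colour m) p = W @ Q" "W \<noteq> []" "mset Q = mset W"
    by (auto simp: anagram_def)
  then obtain p1 p2 where p: "p = p1 @ p2" "map (colour m) p1 = W" "map (colour m) p2 = Q"
    by (auto simp: map_eq_append_conv)
  have "p1 \<noteq> []" "p2 \<noteq> []" using p WQ by auto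
  moreover have "mset (map (colour m) p1) = mset (map (colour m) p2)" using p WQ by simp
  ultimately show False
    using split_in_single_edge[of p1 p2] split_at_branch_vertex[of p1 p2] assms unfolding p(1) by blast
qed

end

section \<open>The subdivision\<close>

lemma vwalk_arcs_conv_zip: "vwalk_arcs xs = zip xs (tl xs)"
  by (induction xs rule: vwalk_arcs.induct) auto

lemma set_vwalk_arcs_map_upt:
  "set (vwalk_arcs (map f [0..<Suc n])) = {(f s, f (Suc s)) | s. s < n}"
proof -
  have "tl (map f [0..<Suc n]) ! s = f (Suc s)" if "s < n" for s
    using that by (simp add: nth_tl del: upt_Suc)
  then show ?thesis
    unfolding vwalk_arcs_conv_zip set_zip by (force simp del: upt_Suc)
qed

lemma set_vwalk_arcs_rev: "set (vwalk_arcs (rev xs)) = (set (vwalk_arcs xs))\<inverse>"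
proof (induction xs rule: vwalk_arcs.induct)
  case (3 x y zs)
  have "vwalk_arcs (rev (x # y # zs)) = vwalk_arcs (rev (y # zs)) @ [(y, x)]"
    using vwalk_arcs_append[of "rev (y # zs)" "[x]"] by (simp add: last_rev)
  with 3 show ?case by auto
qed auto

lemma successively_vwalk_arcs: "set (vwalk_arcs p) \<subseteq> A \<Longrightarrow> successively (\<lambda>x y. (x, y) \<in> A) p"
  by (induction p rule: vwalk_arcs.induct) auto

section \<open>The subdivided graph and the lengths of its edges\<close>

context subdivided_edges
begin

definition graph :: "'a set \<Rightarrow> ('a + nat) pair_pre_digraph" where
  "graph V = \<lparr>pverts = Inl ` V \<union> (\<Union>i<m. division i ` {1..<edge_end m i}), parcs = {(x, y). adj x y}\<rparr>"

definition division_list :: "nat \<Rightarrow> ('a + nat) list" where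
  "division_list i = map (division i) [1..<edge_end m i]"

lemma edge_end_gt_1: "1 < edge_end m i"
  using seg_start_less_iff[of m i 0 7] seg_start_pos[of m i 0] by linarith

lemma adj_irrefl: "\<not> adj x x"
proof
  assume "adj x x"
  then obtain i s where "s < edge_end m i" "point i s = point i (Suc s)"
    by (auto simp: adj_def doubleton_eq_iff)
  then show False using edge_end_gt_1[of i] by (auto simp: point_def split: if_splits)
qed

lemma adj_iff: "adj x y \<longleftrightarrow> (\<exists>i<m. \<exists>s<edge_end m i.
    (x, y) = (point i s, point i (Suc s)) \<or> (y, x) = (point i s, point i (Suc s)))"
  unfolding adj_def doubleton_eq_iff by auto

lemma division_list_path: "Inl (a i) # division_list i @ [Inl (b i)] = map (point i) [0..<Suc (edge_end m i)]"
proof -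
  have "[0..<Suc (edge_end m i)] = 0 # [1..<edge_end m i] @ [edge_end m i]"
    using edge_end_gt_1[of i] by (simp add: upt_conv_Cons)
  then show ?thesis
    using edge_end_gt_1[of i] by (auto simp: division_list_def point_def)
qed

lemma pair_graph_graph:
  assumes "finite V" "\<And>i. i < m \<Longrightarrow> a i \<in> V \<and> b i \<in> V"
  shows "pair_graph (graph V)"
proof -
  have fin: "finite (pverts (graph V))"
    using assms(1) by (simp add: graph_def)
  have wf: "x \<in> pverts (graph V)" if "adj x y" for x y
    using that
  proof (cases rule: adj_cases)
    case (division i t)
    then have "x \<in> division i ` {1..<edge_end m i}" by simp
    with division(1) show ?thesis unfolding graph_def by auto
  qed (use assms(2) in \<open>auto simp: graph_def\<close>)
  have arcs: "parcs (graph V) = {(x, y). adj x y}"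
    by (simp add: graph_def)
  have subset: "parcs (graph V) \<subseteq> pverts (graph V) \<times> pverts (graph V)"
    unfolding arcs using wf adj_sym by blast
  then have "finite (parcs (graph V))"
    by (rule finite_subset) (use fin in simp)
  moreover have "sym (parcs (graph V))"
    unfolding arcs sym_def using adj_sym by blast
  moreover have "fst e \<noteq> snd e" if "e \<in> parcs (graph V)" for e
    using that adj_irrefl unfolding arcs by (metis case_prod_unfold mem_Collect_eq)
  ultimately show ?thesis
    using fin subset by unfold_locales (auto simp: symmetric_def)
qed

lemma anagram_free_colouring_graph: "anagram_free_colouring (graph V) (colour m)"
  unfolding anagram_free_colouring_def
proof (intro allI impI)
  fix p assume "vpath p (with_proj (graph V))"
  then have "distinct p" "set (vwalk_arcs p) \<subseteq> {(x, y). adj x y}"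
    by (auto simp: vpath_def vwalk_def graph_def)
  with successively_vwalk_arcs[OF this(2)] show "\<not> anagram (map (colour m) p)"
    by (intro path_not_anagram) auto
qed

text \<open>Three segments of size \<open>4 ^ i\<close>, three of size \<open>2 * 4 ^ i\<close> and
  the middle one have at most \<open>12 * 4 ^ n\<close> zeros together, where
  \<open>n = m - 1\<close>; \<open>zero_pos_upper\<close> costs another factor 16 and a
  constant.\<close>

lemma length_division_list_le:
  assumes "i < m"
  shows "real (length (division_list i)) \<le> 45 * (1 + 75 / 9) powi (2 * int m - 1)"
proof -
  obtain n where n: "m = Suc n" using assms by (cases m) auto
  have "i \<le> n" using assms n by simp
  have sum: "(\<Sum>j<7. seg_size m i j) = 9 * 4 ^ i + (2 * m + 1) * 2 ^ i"
    by (simp add: seg_size_def eval_nat_numeral)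
  have "2 * k + 3 \<le> 3 * 2 ^ k" for k :: nat
    by (induction k) auto
  from this[of n] have "2 * m + 1 \<le> 3 * 2 ^ n" by (simp add: n)
  then have "(2 * m + 1) * 2 ^ i \<le> 3 * 2 ^ n * 2 ^ n"
    using \<open>i \<le> n\<close> by (intro mult_le_mono power_increasing) auto
  also have "\<dots> = 3 * 4 ^ n" by (simp add: power_mult_distrib[symmetric])
  finally have "(2 * m + 1) * 2 ^ i \<le> 3 * 4 ^ n" .
  moreover have "(4 :: nat) ^ i \<le> 4 ^ n"
    using \<open>i \<le> n\<close> by (rule power_increasing) simp
  ultimately have "9 * 4 ^ i + (2 * m + 1) * 2 ^ i \<le> 12 * (4 :: nat) ^ n"
    by linarith
  moreover have "edge_end m i < 16 * (1 + (\<Sum>j<7. seg_size m i j)) + 16"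
    unfolding seg_start_def by (rule zero_pos_upper)
  ultimately have "length (division_list i) \<le> 192 * 4 ^ n + 30"
    unfolding sum by (simp add: division_list_def)
  moreover have "1 \<le> (4 :: nat) ^ n" by simp
  \<comment> \<open>The factor 420 is \<open>45 * (28 / 3)\<close>, where
    \<open>28 / 3 = 1 + 75 / 9\<close>; the square \<open>784 / 9\<close> of this base exceeds
    4.\<close>
  ultimately have "length (division_list i) \<le> 420 * 4 ^ n" by linarith
  then have "real (length (division_list i)) \<le> real (420 * 4 ^ n)"
    by (rule of_nat_mono)
  also have "\<dots> = 420 * 4 ^ n" by simp
  also have "\<dots> \<le> 420 * (784 / 9) ^ n"
    by (intro mult_left_mono power_mono) auto
  also have "\<dots> = 45 * (28 / 3) ^ (2 * n + 1)"
    by (simp add: power_mult power2_eq_square)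
  also have "\<dots> = 45 * (1 + 75 / 9) powi int (2 * n + 1)"
    by (simp only: power_int_of_nat) simp
  also have "int (2 * n + 1) = 2 * int m - 1" by (simp add: n)
  finally show ?thesis .
qed

end

section \<open>Assembling the subdivision of an arbitrary graph\<close>

theorem theorem6:
  fixes G :: "'a pair_pre_digraph"
  assumes "pair_graph G"
  shows "\<exists>S :: ('a + nat) pair_pre_digraph.
    le_subdivision (45 * (1 + 75 / 9) powi (2 * int (card (uedges G)) - 1)) G S \<and> phi S \<le> 8"
proof -
  interpret pair_graph G by fact
  define m where "m = card (uedges G)"
  have "finite (uedges G)"
    by (rule finite_subset[of _ "Pow (pverts G)"])
      (auto simp: uedges_def in_arcsD1 in_arcsD2 pair_finite_verts)
  then obtain e where e: "bij_betw e {0..<m} (uedges G)"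
    unfolding m_def using ex_bij_betw_nat_finite by blast
  have "\<exists>u v. e i = {u, v} \<and> (u, v) \<in> parcs G" if "i < m" for i
    using bij_betwE[OF e] that by (auto simp: uedges_def)
  \<comment> \<open>This fixes an orientation of every edge, from \<open>a i\<close> to
    \<open>b i\<close>.\<close>
  then obtain a b where ab: "\<And>i. i < m \<Longrightarrow> e i = {a i, b i} \<and> (a i, b i) \<in> parcs G"
    by metis
  interpret E: subdivided_edges m a b .
  let ?S = "E.graph (pverts G)"
  define idx where "idx = the_inv_into {0..<m} e"
  have idx: "idx {u, v} < m" "e (idx {u, v}) = {u, v}" if "(u, v) \<in> parcs G" for u v
  proof -
    have uv: "{u, v} \<in> e ` {0..<m}"
      using that e by (auto simp: uedges_def bij_betw_def)
    have inj: "inj_on e {0..<m}" using e by (simp add: bij_betw_def)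
    show "idx {u, v} < m"
      using the_inv_into_into[OF inj uv order_refl] by (simp add: idx_def)
    show "e (idx {u, v}) = {u, v}"
      unfolding idx_def by (rule f_the_inv_into_f[OF inj uv])
  qed
  have idx_e: "idx {a i, b i} = i" if "i < m" for i
    using the_inv_into_f_f[of e "{0..<m}" i] e that ab[OF that] by (simp add: idx_def bij_betw_def)
  have neq: "a i \<noteq> b i" if "i < m" for i
    using ab[OF that] by (auto dest: no_loops')
  \<comment> \<open>The test on \<open>u\<close> recognises the chosen orientation; as
    \<open>G\<close> has no loops, exactly one of the two arcs of an edge passes it.\<close>
  define D where "D = (\<lambda>(u, v). if u = a (idx {u, v}) then E.division_list (idx {u, v})
      else rev (E.division_list (idx {u, v})))"
  have ends: "u = a i \<and> v = b i \<or> u = b i \<and> v = a i" if "(u, v) \<in> parcs G" "i = idx {u, v}" for u v i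
    using idx[OF that(1)] ab[of i] that(2) by (auto simp: doubleton_eq_iff)
  have set_D: "set (D (u, v)) = E.division (idx {u, v}) ` {1..<edge_end m (idx {u, v})}" for u v
    by (simp add: D_def E.division_list_def)
  have "subdivides G ?S Inl D"
    unfolding subdivides_def
  proof (intro conjI)
    show "pair_graph ?S"
      using pair_finite_verts ab in_arcsD1 in_arcsD2 by (intro E.pair_graph_graph) blast+
    show "\<forall>(u, v)\<in>parcs G. D (v, u) = rev (D (u, v)) \<and> distinct (D (u, v)) \<and> set (D (u, v)) \<inter> Inl ` pverts G = {}"
    proof (intro ballI, clarify, intro conjI)
      fix u v assume uv: "(u, v) \<in> parcs G"
      define i where "i = idx {u, v}"
      have i: "idx {v, u} = i" "idx {u, v} = i" by (simp_all add: i_def insert_commute)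
      have "u \<noteq> v" using uv by (rule no_loops')
      then show "D (v, u) = rev (D (u, v))"
        using ends[OF uv i_def] unfolding D_def prod.case i by auto
      show "distinct (D (u, v))"
        by (auto simp: D_def E.division_list_def distinct_map inj_on_def)
      show "set (D (u, v)) \<inter> Inl ` pverts G = {}"
        by (auto simp: set_D)
    qed
    have "set (D (u, v)) \<inter> set (D (x, y)) = {}"
      if "(u, v) \<in> parcs G" "(x, y) \<in> parcs G" "{u, v} \<noteq> {x, y}" for u v x y
    proof -
      have "idx {u, v} \<noteq> idx {x, y}" using idx(2)[OF that(1)] idx(2)[OF that(2)] that(3) by metis
      then show ?thesis by (auto simp: set_D)
    qed
    then show "\<forall>(u, v)\<in>parcs G. \<forall>(x, y)\<in>parcs G. {u, v} \<noteq> {x, y} \<longrightarrow> set (D (u, v)) \<inter> set (D (x, y)) = {}"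
      by blast
    show "pverts ?S = Inl ` pverts G \<union> (\<Union>e\<in>parcs G. set (D e))"
    proof -
      have "(\<Union>i<m. E.division i ` {1..<edge_end m i}) = (\<Union>e\<in>parcs G. set (D e))"
      proof (intro equalityI subsetI)
        fix x assume "x \<in> (\<Union>i<m. E.division i ` {1..<edge_end m i})"
        then obtain i where i: "i < m" "x \<in> E.division i ` {1..<edge_end m i}" by blast
        then have "x \<in> set (D (a i, b i))" by (simp add: set_D idx_e)
        with ab[OF i(1)] show "x \<in> (\<Union>e\<in>parcs G. set (D e))" by blast
      next
        fix x assume "x \<in> (\<Union>e\<in>parcs G. set (D e))"
        then obtain u v where uv: "(u, v) \<in> parcs G" "x \<in> set (D (u, v))" by auto
        with idx(1)[OF uv(1)] show "x \<in> (\<Union>i<m. E.division i ` {1..<edge_end m i})"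
          unfolding set_D by blast
      qed
      then show ?thesis by (simp add: E.graph_def)
    qed
    \<comment> \<open>Each arc of \<open>G\<close> contributes the steps of its path in one
      direction only; the two arcs of an edge together give the symmetric relation
      \<open>adj\<close>.\<close>
    have arcs: "set (vwalk_arcs (Inl u # D (u, v) @ [Inl v])) =
        (if u = a i then {(E.point i s, E.point i (Suc s)) | s. s < edge_end m i}
         else {(E.point i (Suc s), E.point i s) | s. s < edge_end m i})"
      if "(u, v) \<in> parcs G" "i = idx {u, v}" for u v i
    proof -
      have D: "D (u, v) = (if u = a i then E.division_list i else rev (E.division_list i))"
        by (simp only: D_def prod.case that(2))
      show ?thesis
      proof (cases "u = a i")
        case True
        then have "v = b i" using ends[OF that] no_loops'[OF that(1)] by auto
        then have path: "Inl u # D (u, v) @ [Inl v] = map (E.point i) [0..<Suc (edge_end m i)]"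
          unfolding E.division_list_path[symmetric] D using True by simp
        show ?thesis unfolding path set_vwalk_arcs_map_upt using True by simp
      next
        case False
        then have "u = b i" "v = a i" using ends[OF that] by auto
        then have path: "Inl u # D (u, v) @ [Inl v] = rev (map (E.point i) [0..<Suc (edge_end m i)])"
          unfolding E.division_list_path[symmetric] D using False by simp
        show ?thesis unfolding path set_vwalk_arcs_rev set_vwalk_arcs_map_upt using False by auto
      qed
    qed
    show "parcs ?S = (\<Union>(u, v)\<in>parcs G. set (vwalk_arcs (Inl u # D (u, v) @ [Inl v])))"
    proof (intro equalityI subsetI)
      fix z assume "z \<in> parcs ?S"
      then obtain x y where z: "z = (x, y)" "E.adj x y" by (auto simp: E.graph_def)
      then obtain i s where i: "i < m" "s < edge_end m i"
        "(x, y) = (E.point i s, E.point i (Suc s)) \<or> (y, x) = (E.point i s, E.point i (Suc s))"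
        unfolding E.adj_iff by blast
      have p: "(a i, b i) \<in> parcs G" "(b i, a i) \<in> parcs G"
        using ab[OF i(1)] arcs_symmetric by auto
      have ix: "i = idx {a i, b i}" "i = idx {b i, a i}"
        using idx_e[OF i(1)] by (simp_all add: insert_commute)
      have "z \<in> set (vwalk_arcs (Inl (a i) # D (a i, b i) @ [Inl (b i)])) \<union>
          set (vwalk_arcs (Inl (b i) # D (b i, a i) @ [Inl (a i)]))"
        unfolding arcs[OF p(1) ix(1)] arcs[OF p(2) ix(2)] using i(2,3) neq[OF i(1)] z(1) by auto
      with p show "z \<in> (\<Union>(u, v)\<in>parcs G. set (vwalk_arcs (Inl u # D (u, v) @ [Inl v])))"
        by blast
    next
      fix z assume "z \<in> (\<Union>(u, v)\<in>parcs G. set (vwalk_arcs (Inl u # D (u, v) @ [Inl v])))"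
      then obtain u v where uv: "(u, v) \<in> parcs G" "z \<in> set (vwalk_arcs (Inl u # D (u, v) @ [Inl v]))"
        by blast
      then obtain s where s: "s < edge_end m (idx {u, v})"
        "z = (E.point (idx {u, v}) s, E.point (idx {u, v}) (Suc s)) \<or>
         z = (E.point (idx {u, v}) (Suc s), E.point (idx {u, v}) s)"
        unfolding arcs[OF uv(1) refl] by (auto split: if_splits)
      then show "z \<in> parcs ?S"
        using idx(1)[OF uv(1)] by (auto simp: E.graph_def E.adj_iff)
    qed
  qed simp
  moreover have "real (length (D arc)) \<le> 45 * (1 + 75 / 9) powi (2 * int m - 1)" if "arc \<in> parcs G" for arc
  proof -
    obtain u v where uv: "arc = (u, v)" by (cases arc)
    then have "length (D arc) = length (E.division_list (idx {u, v}))" by (simp add: D_def)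
    then show ?thesis using E.length_division_list_le[OF idx(1)] that uv by simp
  qed
  ultimately have "le_subdivision (45 * (1 + 75 / 9) powi (2 * int m - 1)) G ?S"
    unfolding le_subdivision_def by blast
  moreover have "pair_graph ?S"
    using pair_finite_verts ab in_arcsD1 in_arcsD2 by (intro E.pair_graph_graph) blast+
  then have "phi ?S \<le> 8"
    using E.anagram_free_colouring_graph colour_less_8 by (subst phi_le_iff) auto
  ultimately show ?thesis unfolding m_def by blast
qed

end
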